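(* Let $\beta>0$, let $\mathbf{s}_j=(x'_j,y'_j)$, $j=1,\dots,N_S$, and $\mathbf{t}_l=(x_l,y_l)$, $l=1,\dots,N_T$, be sources and targets in the unit cell $\mathcal{C}$, and let $\mathbf{P}_2^{south}$ be the $N_T\times N_S$ matrix with entries $\mathbf{P}_2^{south}(l,j)=K_2^{south}(\mathbf{t}_l,\mathbf{s}_j)$. Given a precision $0<\epsilon<1$, let $$M=\left\lceil\frac{d}{2\pi\eta}\log\left(\frac{1}{1-e^{-2\pi\eta/d}}\,\frac1\epsilon\right)\right\rceil .$$ For $m=-M,\dots,M$ let $$\alpha_m=\frac{2\pi m}{d},\qquad \chi_m=\sqrt{\alpha_m^2+\beta^2},\qquad Q_m=\chi_m\eta-i\alpha_m\xi .$$ Let $\mathbf{L}^{south}\in\mathbb{C}^{N_T\times(2M+1)}$, $\mathbf{R}^{south}\in\mathbb{C}^{(2M+1)\times N_S}$ and the diagonal matrix $\mathbf{D}^{south}\in\mathbb{C}^{(2M+1)\times(2M+1)}$ be given by $$\mathbf{L}^{south}(l,m)=e^{-\chi_m y_l}e^{i\alpha_m x_l},\quad \mathbf{R}^{south}(m,j)=e^{\chi_m y'_j}e^{-i\alpha_m x'_j},\quad \mathbf{D}^{south}(m,m)=\frac{1}{2d\,\chi_m}\,\frac{e^{-2Q_m}}{1-e^{-Q_m}}.$$ Then $$\mathbf{P}_2^{south}=\mathbf{L}^{south}\,\mathbf{D}^{south}\,\mathbf{R}^{south}+O(\epsilon).$$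
   Context: Let $d,\eta>0$ and $\xi\in\mathbb{R}$ with $d\ge\sqrt{\xi^2+\eta^2}$, $\mathbf{e}_1=(d,0)$, $\mathbf{e}_2=(\xi,\eta)$, $\mathcal{C}=\{x_1\mathbf{e}_1+x_2\mathbf{e}_2 : x_1,x_2\in[-\tfrac12,\tfrac12]\}$, $\mathbf{l}_{mn}=m\mathbf{e}_1+n\mathbf{e}_2$. $G(\mathbf{t},\mathbf{s})=\frac{1}{2\pi}K_0(\beta\|\mathbf{t}-\mathbf{s}\|)$ is the modified Helmholtz Green's function ($K_0$ the modified Bessel function of the second kind), and $$K_2^{south}(\mathbf{t},\mathbf{s})=\sum_{n=-\infty}^{-2}\sum_{m=-\infty}^{\infty}G(\mathbf{t},\mathbf{s}+\mathbf{l}_{mn}).$$ $O(\epsilon)$ denotes a matrix all of whose entries are bounded in absolute value by $C\epsilon$, where $C$ is independent of $\epsilon$ and of the number and locations of sources and targets ($C$ may depend on $d,\xi,\eta,\beta$). Rows/columns indexed by $m$ run over $-M,\dots,M$. *)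

theory Defs
  imports "HOL-Analysis.Analysis" "Jordan_Normal_Form.Matrix"
begin

text \<open>
  The plane is \<^typ>\<open>real \<times> real\<close>, whose norm is the Euclidean norm.
\<close>

definition e1 :: "real \<Rightarrow> real \<times> real" where
  "e1 d = (d, 0)"

definition e2 :: "real \<Rightarrow> real \<Rightarrow> real \<times> real" where
  "e2 \<xi> \<eta> = (\<xi>, \<eta>)"

definition unit_cell :: "real \<Rightarrow> real \<Rightarrow> real \<Rightarrow> (real \<times> real) set" where
  "unit_cell d \<xi> \<eta> = {x1 *\<^sub>R e1 d + x2 *\<^sub>R e2 \<xi> \<eta> | x1 x2. x1 \<in> {-1/2..1/2} \<and> x2 \<in> {-1/2..1/2}}"

definition lattice_pt :: "real \<Rightarrow> real \<Rightarrow> real \<Rightarrow> int \<Rightarrow> int \<Rightarrow> real \<times> real" where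
  "lattice_pt d \<xi> \<eta> m n = of_int m *\<^sub>R e1 d + of_int n *\<^sub>R e2 \<xi> \<eta>"

text \<open>
  The modified Bessel function of the second kind and order 0, for positive argument,
  by its standard integral representation (DLMF 10.32.9).
\<close>

definition bessel_K0 :: "real \<Rightarrow> real" where
  "bessel_K0 x = integral {0..} (\<lambda>u. exp (- x * cosh u))"

definition green :: "real \<Rightarrow> real \<times> real \<Rightarrow> real \<times> real \<Rightarrow> real" where
  "green \<beta> t s = 1 / (2 * pi) * bessel_K0 (\<beta> * norm (t - s))"

definition K2_south :: "real \<Rightarrow> real \<Rightarrow> real \<Rightarrow> real \<Rightarrow> real \<times> real \<Rightarrow> real \<times> real \<Rightarrow> real" where
  "K2_south d \<xi> \<eta> \<beta> t s =
     (\<Sum>\<^sub>\<infinity>n\<in>{..-2::int}. \<Sum>\<^sub>\<infinity>m\<in>(UNIV::int set). green \<beta> t (s + lattice_pt d \<xi> \<eta> m n))"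

definition trunc_M :: "real \<Rightarrow> real \<Rightarrow> real \<Rightarrow> nat" where
  "trunc_M d \<eta> \<epsilon> =
     nat \<lceil>d / (2 * pi * \<eta>) * ln (1 / (1 - exp (- 2 * pi * \<eta> / d)) * (1 / \<epsilon>))\<rceil>"

definition alpha :: "real \<Rightarrow> int \<Rightarrow> real" where
  "alpha d m = 2 * pi * of_int m / d"

definition chi :: "real \<Rightarrow> real \<Rightarrow> int \<Rightarrow> real" where
  "chi d \<beta> m = sqrt ((alpha d m)\<^sup>2 + \<beta>\<^sup>2)"

definition Qm :: "real \<Rightarrow> real \<Rightarrow> real \<Rightarrow> real \<Rightarrow> int \<Rightarrow> complex" where
  "Qm d \<xi> \<eta> \<beta> m = of_real (chi d \<beta> m * \<eta>) - \<i> * of_real (alpha d m * \<xi>)"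

text \<open>
  Matrix indices start at 0: target and source indices run over \<open>0..<NT\<close> and \<open>0..<NS\<close>,
  and the index \<open>i < 2 * M + 1\<close> stands for the mode number \<open>m = i - M\<close> in \<open>{-M..M}\<close>.
\<close>

definition mode :: "nat \<Rightarrow> nat \<Rightarrow> int" where
  "mode M i = int i - int M"

definition P2_south :: "real \<Rightarrow> real \<Rightarrow> real \<Rightarrow> real \<Rightarrow>
    nat \<Rightarrow> nat \<Rightarrow> (nat \<Rightarrow> real \<times> real) \<Rightarrow> (nat \<Rightarrow> real \<times> real) \<Rightarrow> complex mat" where
  "P2_south d \<xi> \<eta> \<beta> NT NS t s =
     Matrix.mat NT NS (\<lambda>(l, j). of_real (K2_south d \<xi> \<eta> \<beta> (t l) (s j)))"

definition L_south :: "real \<Rightarrow> real \<Rightarrow> nat \<Rightarrow> nat \<Rightarrow> (nat \<Rightarrow> real \<times> real) \<Rightarrow> complex mat" where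
  "L_south d \<beta> M NT t = Matrix.mat NT (2 * M + 1) (\<lambda>(l, i). let m = mode M i in
     of_real (exp (- chi d \<beta> m * snd (t l))) * exp (\<i> * of_real (alpha d m * fst (t l))))"

definition R_south :: "real \<Rightarrow> real \<Rightarrow> nat \<Rightarrow> nat \<Rightarrow> (nat \<Rightarrow> real \<times> real) \<Rightarrow> complex mat" where
  "R_south d \<beta> M NS s = Matrix.mat (2 * M + 1) NS (\<lambda>(i, j). let m = mode M i in
     of_real (exp (chi d \<beta> m * snd (s j))) * exp (- \<i> * of_real (alpha d m * fst (s j))))"

definition D_south :: "real \<Rightarrow> real \<Rightarrow> real \<Rightarrow> real \<Rightarrow> nat \<Rightarrow> complex mat" where
  "D_south d \<xi> \<eta> \<beta> M = mat_diag (2 * M + 1) (\<lambda>i. let m = mode M i in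
     1 / of_real (2 * d * chi d \<beta> m) *
       (exp (- 2 * Qm d \<xi> \<eta> \<beta> m) / (1 - exp (- Qm d \<xi> \<eta> \<beta> m))))"

end

theory Submission
  imports Defs "HOL-Complex_Analysis.Complex_Analysis" "HOL-Real_Asymp.Real_Asymp"
begin

text \<open>
  Rotating the line of integration in the integral representation of \<open>K\<^sub>0\<close> shows that, for \<open>Y > 0\<close>,
  \<open>2 K\<^sub>0(\<beta> |(x, Y)|)\<close> is the Fourier transform at \<open>x\<close> of \<open>exp (-Y \<chi>(p)) / \<chi>(p)\<close> with
  \<open>\<chi>(p) = sqrt (p\<^sup>2 + \<beta>\<^sup>2)\<close>. Poisson summation then turns each lattice row of Green's functions into
  a series over the modes \<open>m\<close>; all rows \<open>n \<le> -2\<close> lie at distance at least \<open>\<eta>\<close> below the target, so the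
  double series converges absolutely and summing over \<open>n\<close> first gives the geometric factor of \<open>D\<close>.
  The mode \<open>m\<close> contributes at most a constant times \<open>exp (-2 \<pi> \<eta> |m| / d)\<close>, and \<open>M\<close> is chosen so that
  the tail \<open>|m| > M\<close> of this geometric series is \<open>O(\<epsilon>)\<close>.
\<close>

section \<open>Fourier series and Poisson summation\<close>

text \<open>Classical localisation argument: if \<open>g 0\<close> were nonzero, trigonometric
  polynomials peaking at 0 would see it, although \<open>g\<close> is orthogonal to all of
  them.\<close>

lemma trig_coeffs_zero_imp_zero:
  fixes g :: "real \<Rightarrow> complex"
  assumes cont: "continuous_on {-pi..pi} g"
    and coeff: "\<And>k::int. integral {-pi..pi} (\<lambda>x. g x * cis (k * x)) = 0"
  shows "g 0 = 0"
proof (rule ccontr)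
  assume "g 0 \<noteq> 0"
  define a where "a = (cmod (g 0))\<^sup>2"
  have a: "a > 0" using \<open>g 0 \<noteq> 0\<close> by (simp add: a_def)
  \<comment> \<open>Multiplying by the conjugate of \<open>g 0\<close> makes the value at 0 the
    positive real number \<open>a\<close>, so that real parts can be estimated from below.\<close>
  define G where "G x = cnj (g 0) * g x" for x
  have contG: "continuous_on {-pi..pi} G"
    unfolding G_def by (intro continuous_intros cont)
  have "G 0 = of_real a"
    unfolding G_def a_def by (subst complex_norm_square) (simp add: mult.commute)
  then have G0: "Re (G 0) = a" by simp
  have "isCont G 0"
    using continuous_on_interior[OF contG, of 0] by simp
  then have "isCont (\<lambda>x. Re (G x)) 0" by (rule isCont_Re)
  then have "\<forall>\<^sub>F x in at 0. Re (G x) > a / 2"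
    unfolding isCont_def using G0 a by (intro order_tendstoD(1)) auto
  then obtain \<delta>0 where \<delta>0: "\<delta>0 > 0" "\<And>x. x \<noteq> 0 \<Longrightarrow> dist x 0 < \<delta>0 \<Longrightarrow> Re (G x) > a / 2"
    unfolding eventually_at by auto
  define \<delta> where "\<delta> = min (\<delta>0 / 2) 1"
  have \<delta>: "\<delta> > 0" "\<delta> < pi / 2" "\<delta> < \<delta>0" using \<delta>0 pi_gt3 by (auto simp: \<delta>_def)
  have G_ge: "Re (G x) \<ge> a / 2" if "\<bar>x\<bar> \<le> \<delta>" for x
    using \<delta>0(2)[of x] that \<delta> G0 a by (cases "x = 0") auto
  obtain B where B: "\<And>x. x \<in> {-pi..pi} \<Longrightarrow> cmod (G x) \<le> B"
    using compact_imp_bounded[OF compact_continuous_image[OF contG compact_Icc]]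
    unfolding bounded_iff by (metis imageI)
  txt \<open>Powers of \<open>T\<close> are trigonometric polynomials that grow geometrically near 0 and stay in \<open>[-1, 1]\<close>
    outside a neighbourhood of 0, so testing \<open>G\<close> against them contradicts \<open>Re (G 0) > 0\<close>.\<close>
  define T where "T x = 1 + cos x - cos \<delta>" for x :: real
  \<comment> \<open>The value of \<open>T\<close> at \<open>\<delta>/2\<close>, hence its minimum on
    the inner interval; it exceeds 1 because cos is strictly decreasing on
    \<open>{0..pi}\<close>.\<close>
  define r where "r = 1 + cos (\<delta>/2) - cos \<delta>"
  have r: "r > 1" unfolding r_def using cos_monotone_0_pi[of "\<delta>/2" \<delta>] \<delta> by simp
  have "cos \<delta> > 0" using \<delta> by (intro cos_gt_zero_pi) auto
  have T_abs: "\<bar>T x\<bar> \<le> 1" if "\<delta> \<le> \<bar>x\<bar>" "\<bar>x\<bar> \<le> pi" for x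
  proof -
    have "cos \<bar>x\<bar> \<le> cos \<delta>" using that \<delta> by (intro cos_monotone_0_pi_le) auto
    then show ?thesis unfolding T_def using \<open>cos \<delta> > 0\<close> cos_le_one[of \<delta>] cos_ge_minus_one[of x]
      unfolding abs_le_iff cos_abs_real by linarith
  qed
  have T_pos: "T x \<ge> 1" if "\<bar>x\<bar> \<le> \<delta>" for x
    using cos_monotone_0_pi_le[of "\<bar>x\<bar>" \<delta>] that \<delta> unfolding T_def by auto
  have T_r: "T x \<ge> r" if "\<bar>x\<bar> \<le> \<delta>/2" for x
    using cos_monotone_0_pi_le[of "\<bar>x\<bar>" "\<delta>/2"] that \<delta> unfolding T_def r_def by auto
  have contT: "continuous_on S T" for S unfolding T_def by (intro continuous_intros)
  \<comment> \<open>By Euler's formula one more factor \<open>T\<close> only mixes the frequencies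
    \<open>k\<close>, \<open>k + 1\<close> and \<open>k - 1\<close>, so the induction must leave
    \<open>k\<close> arbitrary.\<close>
  have zero: "integral {-pi..pi} (\<lambda>x. G x * of_real (T x ^ n) * cis (of_int k * x)) = 0"
    for n :: nat and k :: int
  proof (induction n arbitrary: k)
    case 0
    show ?case using coeff[of k]
      by (simp add: G_def mult.assoc)
  next
    case (Suc n)
    let ?f = "\<lambda>k::int. \<lambda>x. G x * of_real (T x ^ n) * cis (of_int k * x)"
    have int: "?f k integrable_on {-pi..pi}" for k
      by (intro integrable_continuous_interval continuous_intros contG contT)
    have "(?f j has_integral 0) {-pi..pi}" for j
      using int[of j] Suc.IH[of j] by (simp only: has_integral_iff simp_thms)
    note has0 = this
    have cos_eq: "complex_of_real (cos x) = (cis x + cis (-x)) / 2" for x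
      by (simp add: complex_eq_iff)
    have eq: "G x * of_real (T x ^ Suc n) * cis (of_int k * x)
      = of_real (1 - cos \<delta>) * ?f k x + (1/2) * ?f (k+1) x + (1/2) * ?f (k-1) x" for x
    proof -
      have "cis (of_int (k+1) * x) = cis (of_int k * x) * cis x"
        "cis (of_int (k-1) * x) = cis (of_int k * x) * cis (-x)"
        by (simp_all add: cis_mult algebra_simps)
      moreover have "complex_of_real (T x ^ Suc n) = of_real (T x ^ n) * of_real (T x)"
        by simp
      moreover have "complex_of_real (T x) = of_real (1 - cos \<delta>) + (cis x + cis (-x)) / 2"
        by (simp add: T_def cos_eq[symmetric])
      moreover have "u * (t * (c + (p + q) / 2)) * z
          = c * (u * t * z) + (1/2) * (u * t * (z * p)) + (1/2) * (u * t * (z * q))"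
        for u t c p q z :: complex
        by (simp add: field_simps)
      ultimately show ?thesis by (simp only:)
    qed
    have "((\<lambda>x. of_real (1 - cos \<delta>) * ?f k x + (1/2) * ?f (k+1) x + (1/2) * ?f (k-1) x)
      has_integral (of_real (1 - cos \<delta>) * 0 + (1/2) * 0 + (1/2) * 0)) {-pi..pi}"
      by (rule has_integral_add has_integral_mult_right has0)+
    then have "integral {-pi..pi} (\<lambda>x. of_real (1 - cos \<delta>) * ?f k x + (1/2) * ?f (k+1) x + (1/2) * ?f (k-1) x) = 0"
      by (simp only: integral_unique) simp
    then show ?case by (simp only: eq)
  qed
  define F where "F n x = Re (G x) * T x ^ n" for n x
  have intF: "(F n has_integral 0) {-pi..pi}" for n
  proof -
    have "(\<lambda>x. G x * of_real (T x ^ n)) integrable_on {-pi..pi}"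
      by (intro integrable_continuous_interval continuous_intros contG contT)
    then have "((\<lambda>x. G x * of_real (T x ^ n)) has_integral 0) {-pi..pi}"
      using zero[of n 0] by (simp add: has_integral_iff)
    from has_integral_Re[OF this] show ?thesis by (simp add: F_def[abs_def])
  qed
  have B0: "B \<ge> 0" using order_trans[OF norm_ge_zero B[of 0]] by simp
  have lower: "(a/2) * r ^ n * \<delta> \<le> 2 * pi * B" for n
  proof -
    \<comment> \<open>A minorant of \<open>F n\<close>: large on the inner interval, where
      \<open>T\<close> is at least \<open>r\<close>, and \<open>- B\<close> elsewhere. Since
      \<open>F n\<close> has integral 0, the growth of \<open>r ^ n\<close> is bounded, which is
      absurd for large \<open>n\<close>.\<close>
    let ?h = "\<lambda>x. - B + (if x \<in> {-(\<delta>/2)..\<delta>/2} then (a/2) * r ^ n else 0)"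
    have h: "(?h has_integral (- B * (2 * pi) + (a/2) * r ^ n * \<delta>)) {-pi..pi}"
    proof (intro has_integral_add)
      show "((\<lambda>x. - B) has_integral - B * (2 * pi)) {-pi..pi}"
        using has_integral_const_real[of "-B" "-pi" pi] by (simp add: mult.commute)
      have "((\<lambda>x. (a/2) * r ^ n) has_integral (a/2) * r ^ n * \<delta>) {-(\<delta>/2)..\<delta>/2}"
        using has_integral_const_real[of "(a/2) * r ^ n" "-(\<delta>/2)" "\<delta>/2"] \<delta> by (simp add: mult.commute)
      then show "((\<lambda>x. if x \<in> {-(\<delta>/2)..\<delta>/2} then (a/2) * r ^ n else 0) has_integral (a/2) * r ^ n * \<delta>) {-pi..pi}"
        using \<delta> by (subst has_integral_restrict) auto
    qed
    have "- B * (2 * pi) + (a/2) * r ^ n * \<delta> \<le> 0"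
    proof (rule has_integral_le[OF h intF])
      fix x assume x: "x \<in> {-pi..pi}"
      have absG: "\<bar>Re (G x)\<bar> \<le> B" using B[OF x] abs_Re_le_cmod[of "G x"] by linarith
      consider "\<bar>x\<bar> \<le> \<delta>/2" | "\<delta>/2 < \<bar>x\<bar>" "\<bar>x\<bar> \<le> \<delta>" | "\<delta> < \<bar>x\<bar>" by linarith
      then show "?h x \<le> F n x"
      proof cases
        case 1
        have "(a/2) * r ^ n \<le> F n x" unfolding F_def
          using 1 G_ge[of x] T_r[of x] \<delta> a r by (intro mult_mono power_mono) auto
        then show ?thesis using 1 B0 by auto
      next
        case 2
        have "0 \<le> F n x" unfolding F_def
          using 2 G_ge[of x] T_pos[of x] \<delta> a by (intro mult_nonneg_nonneg zero_le_power) auto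
        then show ?thesis using 2 B0 by auto
      next
        case 3
        have "\<bar>F n x\<bar> \<le> B * 1" unfolding F_def abs_mult power_abs
          using 3 absG T_abs[of x] x B0 by (intro mult_mono power_le_one) auto
        then show ?thesis using 3 \<delta> by auto
      qed
    qed
    then show ?thesis by (simp add: mult_ac)
  qed
  obtain n where n: "r ^ n > 2 * pi * B / ((a/2) * \<delta>)"
    using real_arch_pow[OF r] by blast
  moreover have "(a/2) * \<delta> > 0" using a \<delta> by simp
  ultimately have "2 * pi * B < r ^ n * ((a/2) * \<delta>)"
    by (simp only: pos_divide_less_eq)
  then have "2 * pi * B < (a/2) * r ^ n * \<delta>" by (simp add: mult_ac)
  then show False using lower[of n] by linarith
qed

lemma has_integral_cis:
  "((\<lambda>x. cis (of_int k * x)) has_integral (if k = 0 then 2 * pi else 0)) {-pi..pi}"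
proof (cases "k = 0")
  case True
  then show ?thesis using has_integral_const_real[of "1::complex" "-pi" pi]
    by (simp add: scaleR_conv_of_real)
next
  case False
  let ?F = "\<lambda>x::real. exp (\<i> * of_int k * of_real x) / (\<i> * of_int k)"
  have "((\<lambda>x. exp (\<i> * of_int k * of_real x)) has_integral (?F pi - ?F (-pi))) {-pi..pi}"
  proof (rule fundamental_theorem_of_calculus)
    fix x :: real
    show "(?F has_vector_derivative exp (\<i> * of_int k * of_real x)) (at x within {-pi..pi})"
      using False
      by (intro has_vector_derivative_real_field) (auto intro!: derivative_eq_intros)
  qed simp
  moreover have "exp (\<i> * of_int k * of_real pi) = exp (\<i> * of_int k * of_real (-pi))"
  proof -
    have "exp (\<i> * of_int k * of_real pi) = exp (\<i> * of_int k * of_real (-pi)) * exp (of_int (2 * k) * (of_real pi * \<i>))"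
      unfolding exp_add[symmetric] by (simp add: algebra_simps)
    also have "exp (of_int (2 * k) * (of_real pi * \<i>)) = 1"
      unfolding exp_eq_1 by auto
    finally show ?thesis by simp
  qed
  ultimately show ?thesis using False by (simp add: cis_conv_exp mult_ac)
qed

text \<open>The absolutely convergent series \<open>S\<close> is continuous and, by termwise
  integration, has the same Fourier coefficients as \<open>f\<close>; uniqueness applied to
  \<open>f - S\<close> then gives equality at 0.\<close>

lemma fourier_series_at_0:
  fixes f :: "real \<Rightarrow> complex" and c :: "int \<Rightarrow> complex"
  assumes cont: "continuous_on {-pi..pi} f"
    and summable: "(\<lambda>k. norm (c k)) summable_on UNIV"
    and coeff: "\<And>k. integral {-pi..pi} (\<lambda>x. f x * cis (- (of_int k * x))) = 2 * pi * c k"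
  shows "(c has_sum f 0) UNIV"
proof -
  define S where "S x = (\<Sum>\<^sub>\<infinity>j. c j * cis (of_int j * x))" for x :: real
  have unif: "uniform_limit {-pi..pi} (\<lambda>X x. \<Sum>j\<in>X. c j * cis (of_int j * x) * cis (- (of_int k * x)))
      (\<lambda>x. S x * cis (- (of_int k * x))) (finite_subsets_at_top UNIV)" for k :: int
  proof -
    have "uniform_limit {-pi..pi} (\<lambda>X x. \<Sum>j\<in>X. c j * cis (of_int j * x) * cis (- (of_int k * x)))
      (\<lambda>x. \<Sum>\<^sub>\<infinity>j. c j * cis (of_int j * x) * cis (- (of_int k * x))) (finite_subsets_at_top UNIV)"
      by (rule Weierstrass_m_test_general[OF _ summable]) (simp add: norm_mult)
    then show ?thesis by (simp add: S_def infsum_cmult_left')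
  qed
  have cont_part: "continuous_on {-pi..pi} (\<lambda>x. \<Sum>j\<in>X. c j * cis (of_int j * x) * cis (- (of_int k * x)))"
    for X :: "int set" and k :: int
    by (intro continuous_intros)
  have "continuous_on {-pi..pi} (\<lambda>x. S x * cis (- (of_int 0 * x)))"
    by (rule uniform_limit_theorem[OF always_eventually unif]) (use cont_part[where k = 0] in auto)
  then have contS: "continuous_on {-pi..pi} S" by simp
  have S_int: "((\<lambda>x. S x * cis (- (of_int k * x))) has_integral 2 * pi * c k) {-pi..pi}" for k :: int
  proof -
    obtain I J where IJ:
      "\<And>X. ((\<lambda>x. \<Sum>j\<in>X. c j * cis (of_int j * x) * cis (- (of_int k * x))) has_integral I X) {-pi..pi}"
      "((\<lambda>x. S x * cis (- (of_int k * x))) has_integral J) {-pi..pi}"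
      "(I \<longlongrightarrow> J) (finite_subsets_at_top UNIV)"
      using uniform_limit_integral[OF unif cont_part, of k] by auto
    \<comment> \<open>By orthogonality only the term \<open>j = k\<close> survives, so these
      integrals are constant as soon as \<open>X\<close> contains \<open>k\<close>.\<close>
    have I: "I X = 2 * pi * c k" if X: "finite X" "k \<in> X" for X
    proof -
      have "((\<lambda>x. \<Sum>j\<in>X. c j * cis (of_int (j - k) * x)) has_integral
          (\<Sum>j\<in>X. c j * (if j - k = 0 then 2 * pi else 0))) {-pi..pi}"
        using X by (intro has_integral_sum has_integral_mult_right has_integral_cis)
      moreover have "c j * cis (of_int (j - k) * x) = c j * cis (of_int j * x) * cis (- (of_int k * x))" for j x
        by (simp add: mult.assoc cis_mult algebra_simps)
      ultimately have "((\<lambda>x. \<Sum>j\<in>X. c j * cis (of_int j * x) * cis (- (of_int k * x))) has_integral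
          (\<Sum>j\<in>X. c j * (if j - k = 0 then 2 * pi else 0))) {-pi..pi}"
        by (simp only:)
      then have "I X = (\<Sum>j\<in>X. c j * (if j - k = 0 then 2 * pi else 0))"
        by (rule has_integral_unique[OF IJ(1)])
      also have "\<dots> = (\<Sum>j\<in>X. if j = k then c k * (2 * pi) else 0)"
        by (intro sum.cong) auto
      finally show ?thesis using X by (simp add: mult.commute)
    qed
    have "\<forall>\<^sub>F X in finite_subsets_at_top UNIV. I X = 2 * pi * c k"
      unfolding eventually_finite_subsets_at_top by (intro exI[of _ "{k}"]) (auto simp: I)
    then have "(I \<longlongrightarrow> 2 * pi * c k) (finite_subsets_at_top UNIV)"
      by (rule tendsto_eventually)
    with IJ(3) have "J = 2 * pi * c k" by (intro tendsto_unique[OF _ IJ(3)]) auto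
    with IJ(2) show ?thesis by simp
  qed
  have "f 0 - S 0 = 0"
  proof (rule trig_coeffs_zero_imp_zero[of "\<lambda>x. f x - S x"])
    show "continuous_on {-pi..pi} (\<lambda>x. f x - S x)" by (intro continuous_intros cont contS)
    fix k :: int
    \<comment> \<open>The frequency is negated because the uniqueness lemma tests against
      \<open>cis (k * x)\<close> while coefficients are taken against
      \<open>cis (- (k * x))\<close>.\<close>
    have "(\<lambda>x. f x * cis (- (of_int (-k) * x))) integrable_on {-pi..pi}"
      by (intro integrable_continuous_interval continuous_intros cont)
    then have "((\<lambda>x. f x * cis (- (of_int (-k) * x))) has_integral 2 * pi * c (-k)) {-pi..pi}"
      using coeff[of "-k"] by (simp only: has_integral_iff simp_thms)
    from has_integral_diff[OF this S_int[of "-k"]]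
    show "integral {-pi..pi} (\<lambda>x. (f x - S x) * cis (of_int k * x)) = 0"
      by (simp add: has_integral_iff algebra_simps)
  qed
  then have "f 0 = infsum c UNIV" by (simp add: S_def)
  then show ?thesis using abs_summable_summable[OF summable] by simp
qed

section \<open>Sums over the integers and Poisson summation\<close>

text \<open>Allows an unordered sum to be evaluated along symmetric blocks, whose translates of
  \<open>{-pi..pi}\<close> join into a single interval.\<close>

lemma filterlim_symmetric_int_intervals:
  "filterlim (\<lambda>N. {- int N..int N}) (finite_subsets_at_top UNIV) sequentially"
  unfolding filterlim_finite_subsets_at_top
proof (intro allI impI)
  fix X :: "int set" assume "finite X \<and> X \<subseteq> UNIV"
  then have "finite ((\<lambda>x. nat \<bar>x\<bar>) ` X)" by auto
  then obtain N0 where N0: "\<forall>x\<in>X. nat \<bar>x\<bar> \<le> N0"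
    unfolding finite_nat_set_iff_bounded_le by auto
  have "finite {- int N..int N} \<and> X \<subseteq> {- int N..int N} \<and> {- int N..int N} \<subseteq> UNIV" if "N0 \<le> N" for N
    using N0 that by fastforce
  then show "\<forall>\<^sub>F N in sequentially. finite {- int N..int N} \<and> X \<subseteq> {- int N..int N} \<and> {- int N..int N} \<subseteq> UNIV"
    unfolding eventually_sequentially by blast
qed

text \<open>Each of the two half-lines carries a geometric series starting with exponent
  \<open>Suc M\<close>. The case \<open>M = 0\<close> yields summability of exponentials, the
  general case the truncation error.\<close>

lemma has_sum_power_int_tail:
  fixes q :: real
  assumes q: "0 \<le> q" "q < 1"
  shows "((\<lambda>m::int. q ^ nat \<bar>m\<bar>) has_sum 2 * q ^ Suc M / (1 - q)) {m. int M < \<bar>m\<bar>}"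
proof -
  have "(\<lambda>n. q ^ Suc M * q ^ n) sums (q ^ Suc M * (1 / (1 - q)))"
    using q by (intro sums_mult geometric_sums) auto
  then have *: "((\<lambda>n. q ^ Suc M * q ^ n) has_sum q ^ Suc M * (1 / (1 - q))) UNIV"
    using q by (intro sums_nonneg_imp_has_sum) auto
  have pos: "((\<lambda>m::int. q ^ nat \<bar>m\<bar>) has_sum q ^ Suc M * (1 / (1 - q))) {int M<..}"
    using * by (subst (asm) has_sum_reindex_bij_witness[where i = "\<lambda>m. nat m - Suc M"
          and j = "\<lambda>n. int n + int (Suc M)" and T = "{int M<..}" and h = "\<lambda>m. q ^ nat \<bar>m\<bar>"])
      (auto simp: nat_add_distrib power_add[symmetric] add_ac)
  have neg: "((\<lambda>m::int. q ^ nat \<bar>m\<bar>) has_sum q ^ Suc M * (1 / (1 - q))) {..<- int M}"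
    using pos by (subst (asm) has_sum_reindex_bij_witness[where i = uminus
          and j = uminus and T = "{..<- int M}" and h = "\<lambda>m. q ^ nat \<bar>m\<bar>"]) auto
  have "{m. int M < \<bar>m\<bar>} = {int M<..} \<union> {..<- int M}" by auto
  moreover have "{int M<..} \<inter> {..<- int M} = {}" by auto
  ultimately show ?thesis using has_sum_Un_disjoint[OF pos neg] by simp
qed

lemma summable_on_exp_minus_abs_int:
  assumes "a > 0"
  shows "(\<lambda>m::int. exp (- a * \<bar>of_int m\<bar>) :: real) summable_on UNIV"
proof -
  have "exp (- a * \<bar>of_int m\<bar>) = exp (- a) ^ nat \<bar>m\<bar>" for m :: int
    by (simp add: exp_of_nat_mult[symmetric] mult.commute)
  moreover have "(\<lambda>m::int. exp (- a) ^ nat \<bar>m\<bar>) summable_on insert 0 {m. int 0 < \<bar>m\<bar>}"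
    unfolding summable_on_insert_iff
    using has_sum_power_int_tail[of "exp (-a)" 0] assms by (auto intro: has_sum_imp_summable)
  moreover have "insert 0 {m. int 0 < \<bar>m\<bar>} = UNIV" by auto
  ultimately show ?thesis by (simp only:)
qed

text \<open>The periodisation \<open>f\<close> of \<open>h\<close> converges uniformly, and
  unfolding its Fourier coefficients over all translates gives the Fourier transform of
  \<open>h\<close>; the series of \<open>f\<close> at 0 is the claim. The transform enters only as a
  limit over intervals ending at odd multiples of pi, which are exactly the unions of
  \<open>2 * N + 1\<close> periods.\<close>

lemma poisson_summation:
  fixes h :: "real \<Rightarrow> complex" and c :: "int \<Rightarrow> complex"
  assumes cont: "continuous_on UNIV h"
    and bound: "\<And>x. norm (h x) \<le> B * exp (- a * \<bar>x\<bar>)" and a: "a > 0"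
    and summable: "(\<lambda>k. norm (c k)) summable_on UNIV"
    and lim: "\<And>k. (\<lambda>N. integral {-((2 * real N + 1) * pi)..(2 * real N + 1) * pi}
                     (\<lambda>x. h x * cis (- (of_int k * x)))) \<longlonglongrightarrow> 2 * pi * c k"
  shows "(c has_sum (\<Sum>\<^sub>\<infinity>m. h (2 * pi * of_int m))) UNIV"
proof -
  define f where "f x = (\<Sum>\<^sub>\<infinity>m. h (x + 2 * pi * of_int m))" for x
  \<comment> \<open>For x in \<open>{-pi..pi}\<close> the argument \<open>x + 2 * pi * m\<close> has
    modulus at least \<open>2 * pi * \<bar>m\<bar> - pi\<close>, which accounts for the factor
    \<open>exp (a * pi)\<close>.\<close>
  define M where "M m = \<bar>B\<bar> * exp (a * pi) * exp (- (2 * pi * a) * \<bar>of_int m\<bar>)" for m :: int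
  have M: "M summable_on UNIV"
    unfolding M_def using a by (intro summable_on_cmult_right summable_on_exp_minus_abs_int) auto
  have h_le: "norm (h (x + 2 * pi * of_int m)) \<le> M m" if x: "x \<in> {-pi..pi}" for x m
  proof -
    have "2 * pi * \<bar>of_int m\<bar> - pi \<le> \<bar>2 * pi * of_int m\<bar> - \<bar>x\<bar>" using x by (auto simp: abs_mult)
    also have "\<dots> \<le> \<bar>x + 2 * pi * of_int m\<bar>" by linarith
    finally have "a * (2 * pi * \<bar>of_int m\<bar> - pi) \<le> a * \<bar>x + 2 * pi * of_int m\<bar>"
      using a by simp
    then have "exp (- a * \<bar>x + 2 * pi * of_int m\<bar>) \<le> exp (a * pi + - (2 * pi * a) * \<bar>of_int m\<bar>)"
      by (simp add: algebra_simps)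
    then have "\<bar>B\<bar> * exp (- a * \<bar>x + 2 * pi * of_int m\<bar>) \<le> M m"
      unfolding M_def mult.assoc exp_add[symmetric] by (intro mult_left_mono) auto
    moreover have "norm (h (x + 2 * pi * of_int m)) \<le> \<bar>B\<bar> * exp (- a * \<bar>x + 2 * pi * of_int m\<bar>)"
      by (rule order_trans[OF bound]) (intro mult_right_mono, auto)
    ultimately show ?thesis by linarith
  qed
  have cont': "continuous_on S (\<lambda>x. h (x + 2 * pi * of_int m))" for S and m :: int
    by (intro continuous_on_compose2[OF cont] continuous_intros) auto
  have unif: "uniform_limit {-pi..pi} (\<lambda>X x. \<Sum>m\<in>X. h (x + 2 * pi * of_int m) * cis (- (of_int k * x)))
      (\<lambda>x. f x * cis (- (of_int k * x))) (finite_subsets_at_top UNIV)" for k :: int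
  proof -
    have "uniform_limit {-pi..pi} (\<lambda>X x. \<Sum>m\<in>X. h (x + 2 * pi * of_int m) * cis (- (of_int k * x)))
      (\<lambda>x. \<Sum>\<^sub>\<infinity>m. h (x + 2 * pi * of_int m) * cis (- (of_int k * x))) (finite_subsets_at_top UNIV)"
      by (rule Weierstrass_m_test_general[OF _ M]) (simp add: norm_mult h_le)
    then show ?thesis by (simp add: f_def infsum_cmult_left')
  qed
  have cont_part: "continuous_on {-pi..pi} (\<lambda>x. \<Sum>m\<in>X. h (x + 2 * pi * of_int m) * cis (- (of_int k * x)))"
    for X :: "int set" and k :: int
    by (intro continuous_intros cont')
  have "continuous_on {-pi..pi} (\<lambda>x. f x * cis (- (of_int 0 * x)))"
    by (rule uniform_limit_theorem[OF always_eventually unif]) (use cont_part[where k = 0] in auto)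
  then have contf: "continuous_on {-pi..pi} f" by simp
  have "(c has_sum f 0) UNIV"
  proof (rule fourier_series_at_0[OF contf summable])
    fix k :: int
    let ?g = "\<lambda>x. h x * cis (- (of_int k * x))"
    have contg: "continuous_on S ?g" for S
      by (intro continuous_intros continuous_on_subset[OF cont]) auto
    have intg: "?g integrable_on {x..y}" for x y
      by (intro integrable_continuous_interval contg)
    obtain I J where IJ:
      "\<And>X. ((\<lambda>x. \<Sum>m\<in>X. h (x + 2 * pi * of_int m) * cis (- (of_int k * x))) has_integral I X) {-pi..pi}"
      "((\<lambda>x. f x * cis (- (of_int k * x))) has_integral J) {-pi..pi}"
      "(I \<longlongrightarrow> J) (finite_subsets_at_top UNIV)"
      using uniform_limit_integral[OF unif cont_part, of k] by auto
    \<comment> \<open>The integral over the m-th period; it equals the integral of the m-th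
      translate over \<open>{-pi..pi}\<close> because the exponential factor is periodic.\<close>
    define A where "A m = integral {-pi + 2 * pi * of_int m..pi + 2 * pi * of_int m} ?g" for m :: int
    have A: "((\<lambda>x. h (x + 2 * pi * of_int m) * cis (- (of_int k * x))) has_integral A m) {-pi..pi}" for m :: int
    proof -
      have per: "cis (- (of_int k * (x + 2 * pi * of_int m))) = cis (- (of_int k * x))" for x
      proof -
        have "- (of_int k * (x + 2 * pi * of_int m)) = - (of_int k * x) + 2 * pi * of_int (- k * m)"
          by (simp add: algebra_simps)
        moreover have "cis (2 * pi * of_int (- k * m)) = 1" by (rule cis_multiple_2pi) simp
        ultimately show ?thesis by (simp only: cis_mult[symmetric] mult_1_right)
      qed
      have "integral {-pi..pi} (?g \<circ> (\<lambda>x. x + 2 * pi * of_int m)) = A m"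
        unfolding A_def by (rule integral_shift[OF contg])
      then have "integral {-pi..pi} (\<lambda>x. h (x + 2 * pi * of_int m) * cis (- (of_int k * x))) = A m"
        unfolding o_def per .
      moreover have "(\<lambda>x. h (x + 2 * pi * of_int m) * cis (- (of_int k * x))) integrable_on {-pi..pi}"
        by (intro integrable_continuous_interval continuous_intros cont')
      ultimately show ?thesis by (simp only: has_integral_iff simp_thms)
    qed
    \<comment> \<open>Going from N to \<open>Suc N\<close> attaches one period at each end of the
      interval.\<close>
    have sumA: "(\<Sum>m\<in>{- int N..int N}. A m) = integral {-((2 * real N + 1) * pi)..(2 * real N + 1) * pi} ?g" for N
    proof (induction N)
      case 0
      then show ?case by (simp add: A_def)
    next
      case (Suc N)
      let ?r = "(2 * real N + 1) * pi" and ?r' = "(2 * real (Suc N) + 1) * pi"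
      have r: "- ?r' \<le> - ?r" "- ?r \<le> ?r" "?r \<le> ?r'" "- ?r \<le> ?r'" by (auto simp: algebra_simps)
      have set: "{- int (Suc N)..int (Suc N)} = insert (- int (Suc N)) (insert (int (Suc N)) {- int N..int N})"
        by auto
      have Am: "A (- int (Suc N)) = integral {- ?r'..- ?r} ?g" "A (int (Suc N)) = integral {?r..?r'} ?g"
        by (simp_all add: A_def algebra_simps)
      have "integral {- ?r'..?r'} ?g = integral {- ?r'..- ?r} ?g + integral {- ?r..?r'} ?g"
        using r intg by (intro Henstock_Kurzweil_Integration.integral_combine[symmetric]) auto
      also have "integral {- ?r..?r'} ?g = integral {- ?r..?r} ?g + integral {?r..?r'} ?g"
        using r intg by (intro Henstock_Kurzweil_Integration.integral_combine[symmetric]) auto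
      finally have "integral {- ?r'..?r'} ?g = A (- int (Suc N)) + (A (int (Suc N)) + (\<Sum>m\<in>{- int N..int N}. A m))"
        using Suc.IH Am by (simp only: add_ac)
      then show ?case unfolding set by (simp del: of_nat_Suc)
    qed
    have "I X = sum A X" if "finite X" for X
    proof -
      have "((\<lambda>x. \<Sum>m\<in>X. h (x + 2 * pi * of_int m) * cis (- (of_int k * x))) has_integral sum A X) {-pi..pi}"
        by (intro has_integral_sum that A)
      then show ?thesis by (rule has_integral_unique[OF IJ(1)])
    qed
    then have I: "I {- int N..int N} = integral {-((2 * real N + 1) * pi)..(2 * real N + 1) * pi} ?g" for N
      by (simp add: sumA)
    have "(\<lambda>N. I {- int N..int N}) \<longlonglongrightarrow> J"
      using IJ(3) filterlim_symmetric_int_intervals by (rule filterlim_compose)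
    moreover have "(\<lambda>N. I {- int N..int N}) \<longlonglongrightarrow> 2 * pi * c k"
      unfolding I by (rule lim)
    ultimately have "J = 2 * pi * c k" by (rule LIMSEQ_unique)
    with IJ(2) show "integral {-pi..pi} (\<lambda>x. f x * cis (- (of_int k * x))) = 2 * pi * c k"
      by (simp only: has_integral_iff)
  qed
  then show ?thesis by (simp add: f_def)
qed

section \<open>The Bessel function as a Fourier transform\<close>

lemma le_cosh:
  assumes "0 \<le> (u::real)"
  shows "u \<le> cosh u"
proof -
  have "1 + u + u\<^sup>2 / 2 \<le> exp u" using assms by (rule exp_lower_Taylor_quadratic)
  moreover have "0 \<le> (u - 1)\<^sup>2" by simp
  then have "2 * u \<le> 1 + u + u\<^sup>2 / 2" using assms by (simp add: power2_diff)
  ultimately have "2 * u \<le> exp u" by linarith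
  also have "\<dots> \<le> exp u + exp (- u)" by simp
  finally show ?thesis by (simp add: cosh_field_def)
qed

text \<open>Dominated convergence with majorant \<open>exp (- c * u)\<close>. The cutoffs
  \<open>R\<close> are arbitrary because they later come from a hyperbolic substitution.\<close>

lemma bessel_K0_truncated_tendsto:
  assumes c: "c > 0" and R: "filterlim R at_top sequentially"
  shows "(\<lambda>u. exp (- c * cosh u)) integrable_on {0..}"
    and "(\<lambda>N. integral {0..R N} (\<lambda>u. exp (- c * cosh u))) \<longlonglongrightarrow> bessel_K0 c"
proof -
  let ?g = "\<lambda>u::real. exp (- c * cosh u)"
  let ?f = "\<lambda>k u. if u \<in> {0..R k} then ?g u else 0"
  have cont: "continuous_on S ?g" for S by (intro continuous_intros)
  have int: "?g integrable_on {0..R k}" for k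
    by (intro integrable_continuous_interval cont)
  have sub: "{0..R k} \<subseteq> {0..}" for k by auto
  have f: "?f k integrable_on {0..}" for k
    using int[of k] unfolding integrable_on_def has_integral_restrict[OF sub] .
  have fint: "integral {0..} (?f k) = integral {0..R k} ?g" for k
    unfolding integral_restrict_Int by (intro arg_cong2[where f = integral]) auto
  have le: "norm (?f k u) \<le> exp (- c * u)" if "u \<in> {0..}" for k u
    using le_cosh[of u] that c by auto
  have conv: "(\<lambda>k. ?f k u) \<longlonglongrightarrow> ?g u" if "u \<in> {0..}" for u
  proof (rule tendsto_eventually)
    have "\<forall>\<^sub>F k in sequentially. R k \<ge> u" using R unfolding filterlim_at_top by blast
    then show "\<forall>\<^sub>F k in sequentially. ?f k u = ?g u"
      by eventually_elim (use that in auto)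
  qed
  note dc = dominated_convergence[OF f integrable_on_exp_minus_to_infinity[OF c] le conv]
  show "?g integrable_on {0..}" by (rule dc(1))
  show "(\<lambda>N. integral {0..R N} ?g) \<longlonglongrightarrow> bessel_K0 c"
    using dc(2) unfolding fint bessel_K0_def .
qed

lemma bessel_K0_integrable:
  "c > (0::real) \<Longrightarrow> (\<lambda>u. exp (- c * cosh u)) integrable_on {0..}"
  by (rule bessel_K0_truncated_tendsto(1)[OF _ filterlim_real_sequentially])

lemma bessel_K0_nonneg: "0 \<le> bessel_K0 c" if "c > 0"
  unfolding bessel_K0_def
  by (rule Henstock_Kurzweil_Integration.integral_nonneg[OF bessel_K0_integrable[OF that]]) simp

text \<open>Since cosh is at least 1, the excess \<open>x - c\<close> splits off as a factor
  \<open>exp (- (x - c))\<close> under the integral. This gives exponential decay relative to a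
  fixed base point \<open>c\<close>.\<close>

lemma bessel_K0_le:
  assumes "0 < c" "c \<le> x"
  shows "bessel_K0 x \<le> exp (- (x - c)) * bessel_K0 c"
proof -
  have "bessel_K0 x \<le> integral {0..} (\<lambda>u. exp (- (x - c)) * exp (- c * cosh u))"
    unfolding bessel_K0_def
  proof (rule integral_le)
    show "(\<lambda>u. exp (- x * cosh u)) integrable_on {0..}"
      using assms by (intro bessel_K0_integrable) auto
    show "(\<lambda>u. exp (- (x - c)) * exp (- c * cosh u)) integrable_on {0..}"
      using assms by (intro integrable_on_mult_right bessel_K0_integrable)
    fix u :: real
    have "(x - c) * 1 \<le> (x - c) * cosh u"
      using assms cosh_real_ge_1 by (intro mult_left_mono) auto
    then show "exp (- x * cosh u) \<le> exp (- (x - c)) * exp (- c * cosh u)"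
      unfolding exp_add[symmetric] by (simp add: algebra_simps)
  qed
  then show ?thesis by (simp add: bessel_K0_def)
qed

lemma bessel_K0_symmetric_tendsto:
  assumes c: "c > 0" and R: "filterlim R at_top sequentially"
  shows "(\<lambda>N. integral {- R N..R N} (\<lambda>u. exp (- c * cosh u))) \<longlonglongrightarrow> 2 * bessel_K0 c"
proof -
  let ?g = "\<lambda>u::real. exp (- c * cosh u)"
  have "2 * integral {0..r} ?g = integral {- r..r} ?g" if "r \<ge> 0" for r
  proof -
    have "?g integrable_on {- r..r}" by (intro integrable_continuous_interval continuous_intros)
    then have "integral {- r..0} ?g + integral {0..r} ?g = integral {- r..r} ?g"
      using that by (intro Henstock_Kurzweil_Integration.integral_combine) auto
    moreover have "integral {- r..- 0} (\<lambda>u. ?g (- u)) = integral {0..r} ?g"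
      by (rule Henstock_Kurzweil_Integration.integral_reflect_real)
    ultimately show ?thesis by simp
  qed
  moreover have "\<forall>\<^sub>F N in sequentially. R N \<ge> 0" using R unfolding filterlim_at_top by blast
  ultimately have "\<forall>\<^sub>F N in sequentially. 2 * integral {0..R N} ?g = integral {- R N..R N} ?g"
    by (auto elim: eventually_mono)
  moreover have "(\<lambda>N. 2 * integral {0..R N} ?g) \<longlonglongrightarrow> 2 * bessel_K0 c"
    by (intro tendsto_mult tendsto_const bessel_K0_truncated_tendsto assms)
  ultimately show ?thesis by (blast intro: Lim_transform_eventually)
qed

section \<open>Rotation of the line of integration and the Fourier transform\<close>

lemma cosh_Complex: "cosh (Complex x y) = Complex (cosh x * cos y) (sinh x * sin y)"
  by (simp add: complex_eq_iff cosh_field_def sinh_field_def Re_exp Im_exp field_simps)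

text \<open>Cauchy's theorem for the strip between the real axis and height \<psi>: there the real
  part of cosh is at least \<open>cosh u * cos \<psi>\<close>, which is positive because \<psi>
  stays below a right angle, so the ends contribute nothing in the limit.\<close>

lemma bessel_K0_rotated_tendsto:
  assumes c: "c > 0" and \<psi>: "\<bar>\<psi>\<bar> < pi / 2" and R: "filterlim R at_top sequentially"
  shows "(\<lambda>N. integral {- R N..R N} (\<lambda>u. exp (- of_real c * cosh (Complex u \<psi>))))
           \<longlonglongrightarrow> of_real (2 * bessel_K0 c)"
proof -
  let ?f = "\<lambda>z. exp (- of_real c * cosh z) :: complex"
  have "?f holomorphic_on UNIV" unfolding cosh_field_def by (intro holomorphic_intros) auto
  txt \<open>With a global primitive \<open>P\<close>, shifting the line of integration only costs the increments of \<open>P\<close>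
    along the two vertical ends, which decay doubly exponentially.\<close>
  then obtain P where P: "\<And>z. (P has_field_derivative ?f z) (at z)"
    using holomorphic_convex_primitive'[OF convex_UNIV open_UNIV] by auto
  have line: "((\<lambda>u. ?f (Complex u t)) has_integral (P (Complex b t) - P (Complex a t))) {a..b}"
    if "a \<le> b" for a b t
  proof (rule fundamental_theorem_of_calculus[OF that])
    fix u
    have "((\<lambda>z. z + Complex 0 t) has_field_derivative 1) (at (of_real u))"
      by (auto intro!: derivative_eq_intros)
    from DERIV_chain2[OF P this]
    have "((\<lambda>z. P (z + Complex 0 t)) has_field_derivative ?f (of_real u + Complex 0 t)) (at (of_real u))"
      by simp
    then have "((\<lambda>x. P (of_real x + Complex 0 t)) has_vector_derivative ?f (of_real u + Complex 0 t)) (at u within {a..b})"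
      by (rule has_vector_derivative_real_field)
    moreover have "of_real x + Complex 0 t = Complex x t" for x by (simp add: complex_eq_iff)
    ultimately show "((\<lambda>x. P (Complex x t)) has_vector_derivative ?f (Complex u t)) (at u within {a..b})"
      by simp
  qed
  have cos_le: "cos \<psi> \<le> cos t" if "\<bar>t\<bar> \<le> \<bar>\<psi>\<bar>" for t
    using cos_monotone_0_pi_le[of "\<bar>t\<bar>" "\<bar>\<psi>\<bar>"] that \<psi> by auto
  have cos_pos: "cos \<psi> > 0" using \<psi> by (intro cos_gt_zero_pi) auto
  \<comment> \<open>Mean value inequality on a vertical segment: \<open>cos \<psi>\<close> is the
    smallest cosine on it, so the derivative of \<open>P\<close> is bounded by the value for height
    \<psi>.\<close>
  have vert: "norm (P (Complex x \<psi>) - P (Complex x 0)) \<le> exp (- c * cos \<psi> * cosh x) * \<bar>\<psi>\<bar>" for x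
  proof -
    define S where "S = {z. Re z = x \<and> \<bar>Im z\<bar> \<le> \<bar>\<psi>\<bar>}"
    have "convex S"
    proof -
      have "S = {z. Re z \<le> x} \<inter> {z. Re z \<ge> x} \<inter> {z. Im z \<le> \<bar>\<psi>\<bar>} \<inter> {z. Im z \<ge> - \<bar>\<psi>\<bar>}"
        unfolding S_def by (auto simp: abs_le_iff)
      then show ?thesis
        by (simp add: convex_Int convex_halfspace_Im_le convex_halfspace_Im_ge convex_halfspace_Re_le convex_halfspace_Re_ge)
    qed
    then have "norm (P (Complex x \<psi>) - P (Complex x 0)) \<le> exp (- c * cos \<psi> * cosh x) * norm (Complex x \<psi> - Complex x 0)"
    proof (rule field_differentiable_bound[where f = P and f' = ?f])
      fix z assume z: "z \<in> S"
      show "(P has_field_derivative ?f z) (at z within S)"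
        by (rule has_field_derivative_at_within[OF P])
      have z_eq: "z = Complex x (Im z)" using z by (simp add: S_def complex_eq_iff)
      have "c * (cosh x * cos \<psi>) \<le> c * (cosh x * cos (Im z))"
        using z c by (intro mult_left_mono cos_le) (auto simp: S_def)
      then show "norm (?f z) \<le> exp (- c * cos \<psi> * cosh x)"
        by (subst z_eq) (simp add: cosh_Complex mult_ac)
    qed (auto simp: S_def)
    also have "norm (Complex x \<psi> - Complex x 0) = \<bar>\<psi>\<bar>"
      by (simp add: cmod_def)
    finally show ?thesis .
  qed
  \<comment> \<open>The discrepancy between the shifted and the real line; it equals the difference
    of the two vertical increments of \<open>P\<close>.\<close>
  define D where "D r = integral {- r..r} (\<lambda>u. ?f (Complex u \<psi>)) - of_real (integral {- r..r} (\<lambda>u. exp (- c * cosh u)))"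
    for r :: real
  have D: "norm (D r) \<le> exp (- (c * cos \<psi>) * r) * (2 * \<bar>\<psi>\<bar>)" if "r \<ge> 0" for r
  proof -
    have r: "- r \<le> r" using that by simp
    have "((\<lambda>u. of_real (exp (- c * cosh u)) :: complex) has_integral
            of_real (integral {- r..r} (\<lambda>u. exp (- c * cosh u)))) {- r..r}"
      by (intro has_integral_of_real integrable_integral integrable_continuous_interval continuous_intros)
    moreover have "of_real (exp (- c * cosh u)) = ?f (Complex u 0)" for u
      unfolding cosh_Complex by (simp add: exp_of_real[symmetric] complex_eq_iff Re_exp Im_exp)
    ultimately have "of_real (integral {- r..r} (\<lambda>u. exp (- c * cosh u))) = P (Complex r 0) - P (Complex (- r) 0)"
      using line[OF r, of 0] by (simp only:) (metis has_integral_unique)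
    then have "D r = (P (Complex r \<psi>) - P (Complex r 0)) - (P (Complex (- r) \<psi>) - P (Complex (- r) 0))"
      unfolding D_def integral_unique[OF line[OF r]] by simp
    then have "norm (D r) \<le> norm (P (Complex r \<psi>) - P (Complex r 0)) + norm (P (Complex (- r) \<psi>) - P (Complex (- r) 0))"
      by (simp only: norm_triangle_ineq4)
    also have "\<dots> \<le> exp (- c * cos \<psi> * cosh r) * \<bar>\<psi>\<bar> + exp (- c * cos \<psi> * cosh (- r)) * \<bar>\<psi>\<bar>"
      by (intro add_mono vert)
    also have "\<dots> = exp (- (c * cos \<psi>) * cosh r) * (2 * \<bar>\<psi>\<bar>)" by simp
    also have "\<dots> \<le> exp (- (c * cos \<psi>) * r) * (2 * \<bar>\<psi>\<bar>)"
      using le_cosh[OF that] c cos_pos by (intro mult_right_mono) auto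
    finally show ?thesis .
  qed
  have "filterlim (\<lambda>N. (c * cos \<psi>) * R N) at_top sequentially"
    using c cos_pos by (intro filterlim_tendsto_pos_mult_at_top[OF tendsto_const _ R]) auto
  then have "((\<lambda>N. exp (- (c * cos \<psi>) * R N)) \<longlonglongrightarrow> 0)"
    by (intro filterlim_compose[OF exp_at_bot]) (simp add: filterlim_uminus_at_top)
  then have "(\<lambda>N. exp (- (c * cos \<psi>) * R N) * (2 * \<bar>\<psi>\<bar>)) \<longlonglongrightarrow> 0"
    by (rule tendsto_mult_left_zero)
  moreover have "\<forall>\<^sub>F N in sequentially. R N \<ge> 0" using R unfolding filterlim_at_top by blast
  then have "\<forall>\<^sub>F N in sequentially. norm (D (R N)) \<le> exp (- (c * cos \<psi>) * R N) * (2 * \<bar>\<psi>\<bar>)"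
    by eventually_elim (rule D)
  ultimately have "(\<lambda>N. D (R N)) \<longlonglongrightarrow> 0" by (rule Lim_null_comparison[rotated])
  moreover have "(\<lambda>N. of_real (integral {- R N..R N} (\<lambda>u. exp (- c * cosh u))) :: complex) \<longlonglongrightarrow> of_real (2 * bessel_K0 c)"
    by (intro tendsto_of_real bessel_K0_symmetric_tendsto c R)
  ultimately have "(\<lambda>N. D (R N) + of_real (integral {- R N..R N} (\<lambda>u. exp (- c * cosh u)))) \<longlonglongrightarrow> 0 + of_real (2 * bessel_K0 c)"
    by (rule tendsto_add)
  then show ?thesis by (simp add: D_def)
qed

text \<open>After a hyperbolic substitution the Fourier integral is the integral for
  \<open>bessel_K0\<close> along a shifted line, with the height of the shift given by the direction
  of the point \<open>(x, Y)\<close>.\<close>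

lemma bessel_K0_fourier_tendsto:
  assumes \<beta>: "\<beta> > 0" and Y: "Y > 0" and L: "filterlim L at_top sequentially"
  shows "(\<lambda>N. integral {- L N..L N} (\<lambda>p. of_real (exp (- Y * sqrt (p\<^sup>2 + \<beta>\<^sup>2)) / sqrt (p\<^sup>2 + \<beta>\<^sup>2)) * cis (p * x)))
           \<longlonglongrightarrow> of_real (2 * bessel_K0 (\<beta> * sqrt (x\<^sup>2 + Y\<^sup>2)))"
proof -
  define r where "r = sqrt (x\<^sup>2 + Y\<^sup>2)"
  \<comment> \<open>The sign makes \<open>- r * cosh (Complex u \<psi>)\<close> have imaginary part
    \<open>x * sinh u\<close>, matching the phase \<open>cis (p * x)\<close>. As an arctangent,
    \<psi> lies strictly within a right angle.\<close>
  define \<psi> where "\<psi> = - arctan (x / Y)"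
  have r: "r > 0" unfolding r_def using Y by (simp add: add_nonneg_pos)
  have "r = Y * sqrt (1 + (x / Y)\<^sup>2)"
  proof -
    have "x\<^sup>2 + Y\<^sup>2 = Y\<^sup>2 * (1 + (x / Y)\<^sup>2)" using Y by (simp add: field_simps)
    then show ?thesis unfolding r_def using Y by (simp add: real_sqrt_mult)
  qed
  moreover have "sqrt (1 + (x / Y)\<^sup>2) \<noteq> 0" by (smt (verit) real_sqrt_gt_0_iff zero_le_power2)
  ultimately have rcos: "r * cos \<psi> = Y" and rsin: "r * sin \<psi> = - x"
    using Y by (simp_all add: \<psi>_def cos_arctan sin_arctan)
  have x_eq: "x = - (r * sin \<psi>)" using rsin by simp
  have \<psi>: "\<bar>\<psi>\<bar> < pi / 2" unfolding \<psi>_def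
    using arctan_lbound[of "x / Y"] arctan_ubound[of "x / Y"] by (simp add: abs_if)
  let ?f = "\<lambda>p. of_real (exp (- Y * sqrt (p\<^sup>2 + \<beta>\<^sup>2)) / sqrt (p\<^sup>2 + \<beta>\<^sup>2)) * cis (p * x)"
  have sq_pos: "p\<^sup>2 + \<beta>\<^sup>2 > 0" for p using \<beta> by (simp add: add_nonneg_pos)
  have contf: "continuous_on S ?f" for S
    by (intro continuous_intros) (use sq_pos in \<open>auto simp: less_imp_neq\<close>)
  txt \<open>The substitution \<open>p = \<beta> sinh u\<close> turns \<open>dp / sqrt (p\<^sup>2 + \<beta>\<^sup>2)\<close> into \<open>du\<close>, and \<open>(Y, -x)\<close> has polar
    coordinates \<open>(r, \<psi>)\<close>.\<close>
  have sub: "integral {- \<beta> * sinh R..\<beta> * sinh R} ?f = integral {- R..R} (\<lambda>u. exp (- of_real (\<beta> * r) * cosh (Complex u \<psi>)))"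
    if "R \<ge> 0" for R
  proof -
    have "((\<lambda>u. (\<beta> * cosh u) *\<^sub>R ?f (\<beta> * sinh u)) has_integral integral {\<beta> * sinh (- R)..\<beta> * sinh R} ?f) {- R..R}"
    proof (rule has_integral_substitution[where c = "\<beta> * sinh (- R)" and d = "\<beta> * sinh R"])
      show "(\<lambda>u. \<beta> * sinh u) ` {- R..R} \<subseteq> {\<beta> * sinh (- R)..\<beta> * sinh R}"
        using \<beta> by (auto simp del: sinh_minus)
    qed (use that \<beta> contf in \<open>auto intro!: derivative_eq_intros\<close>)
    moreover have "(\<beta> * cosh u) *\<^sub>R ?f (\<beta> * sinh u) = exp (- of_real (\<beta> * r) * cosh (Complex u \<psi>))" for u
    proof -
      have sq: "sqrt ((\<beta> * sinh u)\<^sup>2 + \<beta>\<^sup>2) = \<beta> * cosh u"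
        using \<beta> by (intro real_sqrt_unique) (auto simp: power_mult_distrib cosh_square_eq algebra_simps)
      have "(\<beta> * cosh u) *\<^sub>R ?f (\<beta> * sinh u) = of_real (exp (- Y * (\<beta> * cosh u))) * cis (\<beta> * sinh u * x)"
        unfolding sq using \<beta> by (simp add: scaleR_conv_of_real)
      also have "\<dots> = exp (Complex (- Y * (\<beta> * cosh u)) (\<beta> * sinh u * x))"
        by (simp add: exp_eq_polar)
      also have "Complex (- Y * (\<beta> * cosh u)) (\<beta> * sinh u * x) = - of_real (\<beta> * r) * cosh (Complex u \<psi>)"
        unfolding cosh_Complex by (simp add: complex_eq_iff rcos[symmetric] x_eq)
      finally show ?thesis .
    qed
    ultimately show ?thesis by (simp add: has_integral_iff)
  qed
  \<comment> \<open>The inverse substitution, so that the endpoints in p are exactly those given by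
    \<open>L\<close>.\<close>
  define R where "R N = arsinh (L N / \<beta>)" for N
  have "filterlim (\<lambda>N. (1 / \<beta>) * L N) at_top sequentially"
    using \<beta> by (intro filterlim_tendsto_pos_mult_at_top[OF tendsto_const _ L]) auto
  then have R: "filterlim R at_top sequentially"
    unfolding R_def by (intro filterlim_compose[OF arsinh_real_at_top]) simp
  have "(\<lambda>N. integral {- R N..R N} (\<lambda>u. exp (- of_real (\<beta> * r) * cosh (Complex u \<psi>))))
           \<longlonglongrightarrow> of_real (2 * bessel_K0 (\<beta> * r))"
    using \<beta> r by (intro bessel_K0_rotated_tendsto \<psi> R) simp
  moreover have "\<forall>\<^sub>F N in sequentially. R N \<ge> 0" using R unfolding filterlim_at_top by blast
  then have "\<forall>\<^sub>F N in sequentially. integral {- R N..R N} (\<lambda>u. exp (- of_real (\<beta> * r) * cosh (Complex u \<psi>)))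
      = integral {- L N..L N} ?f"
  proof eventually_elim
    case (elim N)
    have "\<beta> * sinh (R N) = L N" using \<beta> by (simp add: R_def)
    with sub[OF elim] show ?case by simp
  qed
  ultimately show ?thesis unfolding r_def by (blast intro: Lim_transform_eventually)
qed

section \<open>Lattice sums of the Green function\<close>

text \<open>Poisson summation for the profile \<open>h\<close>, rescaled by \<open>d\<close> so that
  its samples at multiples of \<open>2 * pi\<close> sit at the frequencies \<open>alpha d m\<close>.
  The k-th coefficient is the transform at \<open>X - k * d\<close>, and \<open>d / pi\<close> is
  \<open>2 * d\<close> divided by \<open>2 * pi\<close>.\<close>

lemma bessel_K0_lattice_sum:
  assumes \<beta>: "\<beta> > 0" and Y: "Y > 0" and d: "d > 0"
  shows "((\<lambda>k. complex_of_real (d / pi * bessel_K0 (\<beta> * sqrt ((X - of_int k * d)\<^sup>2 + Y\<^sup>2)))) has_sum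
           (\<Sum>\<^sub>\<infinity>m. of_real (exp (- Y * chi d \<beta> m) / chi d \<beta> m) * cis (alpha d m * X))) UNIV"
proof -
  define w where "w p = exp (- Y * sqrt (p\<^sup>2 + \<beta>\<^sup>2)) / sqrt (p\<^sup>2 + \<beta>\<^sup>2)" for p :: real
  define h where "h x = of_real (w (x / d)) * cis (x / d * X)" for x
  define c where "c k = complex_of_real (d / pi * bessel_K0 (\<beta> * sqrt ((X - of_int k * d)\<^sup>2 + Y\<^sup>2)))" for k :: int
  have sq_pos: "p\<^sup>2 + \<beta>\<^sup>2 > 0" for p using \<beta> by (simp add: add_nonneg_pos)
  have contw: "continuous_on S w" for S
    unfolding w_def by (intro continuous_intros) (use sq_pos in \<open>auto simp: less_imp_neq\<close>)
  have conth: "continuous_on S h" for S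
    unfolding h_def
    by (intro continuous_intros continuous_on_compose2[OF contw[of UNIV]]) (use d in auto)
  \<comment> \<open>The square root is at least the absolute frequency in the exponent and at least
    \<beta> in the denominator.\<close>
  have h_le: "norm (h x) \<le> 1 / \<beta> * exp (- (Y / d) * \<bar>x\<bar>)" for x
  proof -
    have "\<bar>x / d\<bar> \<le> sqrt ((x / d)\<^sup>2 + \<beta>\<^sup>2)" by (rule real_sqrt_ge_abs1)
    then have "Y * \<bar>x / d\<bar> \<le> Y * sqrt ((x / d)\<^sup>2 + \<beta>\<^sup>2)"
      using Y by (intro mult_left_mono) auto
    then have "exp (- Y * sqrt ((x / d)\<^sup>2 + \<beta>\<^sup>2)) \<le> exp (- (Y / d) * \<bar>x\<bar>)"
      using d by simp
    moreover have "\<beta> \<le> sqrt ((x / d)\<^sup>2 + \<beta>\<^sup>2)" using \<beta> by (intro real_le_rsqrt) auto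
    ultimately have "w (x / d) \<le> exp (- (Y / d) * \<bar>x\<bar>) / \<beta>"
      unfolding w_def using \<beta> by (intro frac_le) auto
    moreover have "w (x / d) \<ge> 0" unfolding w_def by simp
    ultimately show ?thesis by (simp add: h_def norm_mult)
  qed
  have summable: "(\<lambda>k. norm (c k)) summable_on UNIV"
  proof (rule Infinite_Sum.abs_summable_on_comparison_test')
    \<comment> \<open>Combines the decay of \<open>bessel_K0\<close> from the base point
      \<open>\<beta> * Y\<close> with the bound
      \<open>r \<ge> \<bar>k\<bar> * d - \<bar>X\<bar>\<close>.\<close>
    let ?B = "d / pi * exp (\<beta> * Y + \<beta> * \<bar>X\<bar>) * bessel_K0 (\<beta> * Y)"
    show "(\<lambda>k::int. ?B * exp (- (\<beta> * d) * \<bar>of_int k\<bar>)) summable_on UNIV"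
      using \<beta> d by (intro summable_on_cmult_right summable_on_exp_minus_abs_int) simp
    fix k :: int
    define r where "r = sqrt ((X - of_int k * d)\<^sup>2 + Y\<^sup>2)"
    have Yr: "Y \<le> r" unfolding r_def using Y by (intro real_le_rsqrt) auto
    have "\<bar>of_int k\<bar> * d - \<bar>X\<bar> \<le> \<bar>X - of_int k * d\<bar>"
      using abs_triangle_ineq2[of "of_int k * d" X] d by (simp add: abs_mult abs_minus_commute)
    also have "\<dots> \<le> r" unfolding r_def by (rule real_sqrt_ge_abs1)
    finally have "\<beta> * (\<bar>of_int k\<bar> * d - \<bar>X\<bar>) \<le> \<beta> * r"
      using \<beta> by (intro mult_left_mono) auto
    then have "exp (- (\<beta> * r - \<beta> * Y)) \<le> exp (\<beta> * Y + \<beta> * \<bar>X\<bar> + - (\<beta> * d) * \<bar>of_int k\<bar>)"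
      by (simp add: algebra_simps)
    moreover have "bessel_K0 (\<beta> * r) \<le> exp (- (\<beta> * r - \<beta> * Y)) * bessel_K0 (\<beta> * Y)"
      using \<beta> Y Yr by (intro bessel_K0_le) auto
    moreover have "bessel_K0 (\<beta> * Y) \<ge> 0" using \<beta> Y by (intro bessel_K0_nonneg) simp
    ultimately have "bessel_K0 (\<beta> * r) \<le> exp (\<beta> * Y + \<beta> * \<bar>X\<bar> + - (\<beta> * d) * \<bar>of_int k\<bar>) * bessel_K0 (\<beta> * Y)"
      by (meson mult_right_mono order_trans)
    then have "d / pi * bessel_K0 (\<beta> * r) \<le> d / pi * (exp (\<beta> * Y + \<beta> * \<bar>X\<bar> + - (\<beta> * d) * \<bar>of_int k\<bar>) * bessel_K0 (\<beta> * Y))"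
      using d by (intro mult_left_mono) auto
    also have "\<dots> = ?B * exp (- (\<beta> * d) * \<bar>of_int k\<bar>)"
      unfolding exp_add by (simp only: mult_ac)
    finally have "d / pi * bessel_K0 (\<beta> * r) \<le> ?B * exp (- (\<beta> * d) * \<bar>of_int k\<bar>)" .
    moreover have "bessel_K0 (\<beta> * r) \<ge> 0" using \<beta> Y Yr by (intro bessel_K0_nonneg) simp
    then have "norm (c k) = d / pi * bessel_K0 (\<beta> * r)"
      unfolding c_def r_def[symmetric] norm_of_real using d by (intro abs_of_nonneg) auto
    ultimately show "norm (c k) \<le> ?B * exp (- (\<beta> * d) * \<bar>of_int k\<bar>)"
      by (simp only:)
  qed
  have lim: "(\<lambda>N. integral {-((2 * real N + 1) * pi)..(2 * real N + 1) * pi}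
                     (\<lambda>x. h x * cis (- (of_int k * x)))) \<longlonglongrightarrow> 2 * pi * c k" for k :: int
  proof -
    \<comment> \<open>The endpoints required by Poisson summation, transported by the substitution
      \<open>x = d * p\<close>.\<close>
    define L where "L N = (2 * real N + 1) * pi / d" for N
    have L: "filterlim L at_top sequentially"
      unfolding L_def using d pi_gt_zero by real_asymp
    let ?f = "\<lambda>p. of_real (w p) * cis (p * (X - of_int k * d))"
    have eq: "integral {-((2 * real N + 1) * pi)..(2 * real N + 1) * pi} (\<lambda>x. h x * cis (- (of_int k * x)))
         = of_real d * integral {- L N..L N} ?f" for N
    proof -
      have "((\<lambda>p. d *\<^sub>R (h (d * p) * cis (- (of_int k * (d * p))))) has_integral
          integral {d * - L N..d * L N} (\<lambda>x. h x * cis (- (of_int k * x)))) {- L N..L N}"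
      proof (rule has_integral_substitution[where c = "d * - L N" and d = "d * L N"])
        show "- L N \<le> L N" using d by (simp add: L_def)
        then show "d * - L N \<le> d * L N" using d by simp
        show "(*) d ` {- L N..L N} \<subseteq> {d * - L N..d * L N}"
          using d by (intro image_subsetI) (simp only: atLeastAtMost_iff mult_le_cancel_left_pos)
        show "continuous_on {d * - L N..d * L N} (\<lambda>x. h x * cis (- (of_int k * x)))"
          by (intro continuous_intros conth)
      qed (auto intro!: derivative_eq_intros)
      moreover have "h (d * p) * cis (- (of_int k * (d * p))) = ?f p" for p
        using d by (simp add: h_def cis_mult mult.assoc algebra_simps)
      ultimately have "integral {- L N..L N} (\<lambda>p. d *\<^sub>R ?f p) = integral {d * - L N..d * L N} (\<lambda>x. h x * cis (- (of_int k * x)))"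
        by (simp only: integral_unique)
      then have "d *\<^sub>R integral {- L N..L N} ?f = integral {d * - L N..d * L N} (\<lambda>x. h x * cis (- (of_int k * x)))"
        by (simp only: integral_cmul)
      moreover have "d * - L N = -((2 * real N + 1) * pi)" "d * L N = (2 * real N + 1) * pi"
        using d by (simp_all add: L_def)
      ultimately show ?thesis by (simp only: scaleR_conv_of_real)
    qed
    have "(\<lambda>N. of_real d * integral {- L N..L N} ?f) \<longlonglongrightarrow>
        of_real d * of_real (2 * bessel_K0 (\<beta> * sqrt ((X - of_int k * d)\<^sup>2 + Y\<^sup>2)))"
      unfolding w_def by (intro tendsto_mult tendsto_const bessel_K0_fourier_tendsto \<beta> Y L)
    also have "of_real d * of_real (2 * bessel_K0 (\<beta> * sqrt ((X - of_int k * d)\<^sup>2 + Y\<^sup>2))) = 2 * pi * c k"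
      by (simp add: c_def)
    finally show ?thesis unfolding eq .
  qed
  have "(c has_sum (\<Sum>\<^sub>\<infinity>m. h (2 * pi * of_int m))) UNIV"
    by (rule poisson_summation[OF conth h_le _ summable lim]) (use Y d in simp)
  moreover have "h (2 * pi * of_int m) = of_real (exp (- Y * chi d \<beta> m) / chi d \<beta> m) * cis (alpha d m * X)" for m
    by (simp add: h_def w_def chi_def alpha_def)
  ultimately show ?thesis by (simp only: c_def[abs_def])
qed

text \<open>The displacement of row n is shifted by n times the second lattice vector. The prefactor
  \<open>1 / (2 * d)\<close> is \<open>1 / (2 * pi)\<close> divided by
  \<open>d / pi\<close>.\<close>

lemma green_row_sum:
  fixes t s :: "real \<times> real"
  defines "X \<equiv> fst t - fst s" and "Y \<equiv> snd t - snd s"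
  assumes \<beta>: "\<beta> > 0" and d: "d > 0" and Y: "Y - of_int n * \<eta> > 0"
  shows "complex_of_real (\<Sum>\<^sub>\<infinity>m. green \<beta> t (s + lattice_pt d \<xi> \<eta> m n)) =
    (\<Sum>\<^sub>\<infinity>m. of_real (exp (- (Y - of_int n * \<eta>) * chi d \<beta> m) / (2 * d * chi d \<beta> m)) * cis (alpha d m * (X - of_int n * \<xi>)))"
proof -
  define X' where "X' = X - of_int n * \<xi>"
  define Y' where "Y' = Y - of_int n * \<eta>"
  have "green \<beta> t (s + lattice_pt d \<xi> \<eta> m n) = 1 / (2 * d) * (d / pi * bessel_K0 (\<beta> * sqrt ((X' - of_int m * d)\<^sup>2 + Y'\<^sup>2)))" for m
  proof -
    have "t - (s + lattice_pt d \<xi> \<eta> m n) = (X' - of_int m * d, Y')"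
      by (cases t; cases s) (simp add: X'_def Y'_def X_def Y_def lattice_pt_def e1_def e2_def)
    then show ?thesis using d by (simp add: green_def norm_Pair)
  qed
  moreover have "((\<lambda>m. of_real (1 / (2 * d)) * complex_of_real (d / pi * bessel_K0 (\<beta> * sqrt ((X' - of_int m * d)\<^sup>2 + Y'\<^sup>2)))) has_sum
     of_real (1 / (2 * d)) * (\<Sum>\<^sub>\<infinity>m. of_real (exp (- Y' * chi d \<beta> m) / chi d \<beta> m) * cis (alpha d m * X'))) UNIV"
    using Y by (intro has_sum_cmult_right bessel_K0_lattice_sum \<beta> d) (simp add: Y'_def)
  ultimately have sum: "((\<lambda>m. complex_of_real (green \<beta> t (s + lattice_pt d \<xi> \<eta> m n))) has_sum
     of_real (1 / (2 * d)) * (\<Sum>\<^sub>\<infinity>m. of_real (exp (- Y' * chi d \<beta> m) / chi d \<beta> m) * cis (alpha d m * X'))) UNIV"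
    (is "(_ has_sum ?S) _")
    by (simp only: of_real_mult)
  \<comment> \<open>An infinite sum that does not converge has the default value 0, so summability
    of the real family must be known before \<open>of_real\<close> is moved through the sum.\<close>
  have "(\<lambda>m. Re (complex_of_real (green \<beta> t (s + lattice_pt d \<xi> \<eta> m n)))) summable_on UNIV"
    using sum by (intro summable_on_Re) (rule has_sum_imp_summable)
  then have "((\<lambda>m. green \<beta> t (s + lattice_pt d \<xi> \<eta> m n)) has_sum (\<Sum>\<^sub>\<infinity>m. green \<beta> t (s + lattice_pt d \<xi> \<eta> m n))) UNIV"
    by simp
  then have "((\<lambda>m. complex_of_real (green \<beta> t (s + lattice_pt d \<xi> \<eta> m n))) has_sum of_real (\<Sum>\<^sub>\<infinity>m. green \<beta> t (s + lattice_pt d \<xi> \<eta> m n))) UNIV"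
    by (rule has_sum_of_real)
  then have "complex_of_real (\<Sum>\<^sub>\<infinity>m. green \<beta> t (s + lattice_pt d \<xi> \<eta> m n)) = ?S"
    using sum by (rule has_sum_unique)
  also have "?S = (\<Sum>\<^sub>\<infinity>m. of_real (exp (- Y' * chi d \<beta> m) / (2 * d * chi d \<beta> m)) * cis (alpha d m * X'))"
    unfolding infsum_cmult_right'[symmetric] by (intro infsum_cong) simp
  finally show ?thesis by (simp only: X'_def Y'_def)
qed

text \<open>The summand of mode \<open>m\<close> of the product \<open>L D R\<close>, before truncation to \<open>{-M..M}\<close>.\<close>

definition mode_term :: "real \<Rightarrow> real \<Rightarrow> real \<Rightarrow> real \<Rightarrow> real \<times> real \<Rightarrow> real \<times> real \<Rightarrow> int \<Rightarrow> complex" where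
  "mode_term d \<xi> \<eta> \<beta> t s m =
     of_real (exp (- chi d \<beta> m * snd t)) * exp (\<i> * of_real (alpha d m * fst t)) *
     (1 / of_real (2 * d * chi d \<beta> m) * (exp (- 2 * Qm d \<xi> \<eta> \<beta> m) / (1 - exp (- Qm d \<xi> \<eta> \<beta> m)))) *
     (of_real (exp (chi d \<beta> m * snd s)) * exp (- \<i> * of_real (alpha d m * fst s)))"

section \<open>Mode terms: summation over rows, interchange of sums and decay\<close>

lemma chi_ge_abs_alpha: "\<bar>alpha d m\<bar> \<le> chi d \<beta> m"
  unfolding chi_def by (rule real_sqrt_ge_abs1)

lemma chi_ge: "\<beta> \<ge> 0 \<Longrightarrow> \<beta> \<le> chi d \<beta> m"
  unfolding chi_def by (intro real_le_rsqrt) auto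

lemma abs_alpha: "d > 0 \<Longrightarrow> \<bar>alpha d m\<bar> = 2 * pi / d * \<bar>of_int m\<bar>"
  by (simp add: alpha_def abs_mult)

lemma norm_exp_Qm: "norm (exp (- Qm d \<xi> \<eta> \<beta> m)) = exp (- (chi d \<beta> m * \<eta>))"
  by (simp add: Qm_def)

text \<open>With \<open>n = - k - 1\<close> the rows form a geometric series of ratio
  \<open>?z\<close>, of norm below 1. The first row \<open>n = -2\<close> corresponds to
  \<open>k = 1\<close> and carries the square of \<open>?z\<close>, whence the numerator
  \<open>exp (- 2 * Qm d \<xi> \<eta> \<beta> m)\<close>.\<close>

lemma has_sum_mode_rows:
  assumes \<eta>: "\<eta> > 0" and \<beta>: "\<beta> > 0"
  shows "((\<lambda>n. of_real (exp (- (snd t - snd s - of_int n * \<eta>) * chi d \<beta> m) / (2 * d * chi d \<beta> m)) *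
      cis (alpha d m * (fst t - fst s - of_int n * \<xi>))) has_sum mode_term d \<xi> \<eta> \<beta> t s m) {..-2::int}"
proof -
  let ?z = "exp (- Qm d \<xi> \<eta> \<beta> m)"
  let ?u = "of_real (exp (- chi d \<beta> m * snd t)) * exp (\<i> * of_real (alpha d m * fst t)) *
      (of_real (exp (chi d \<beta> m * snd s)) * exp (- \<i> * of_real (alpha d m * fst s))) / of_real (2 * d * chi d \<beta> m)"
  have "chi d \<beta> m > 0" using chi_ge[of \<beta> d m] \<beta> by simp
  then have "norm ?z < 1" using \<eta> by (simp add: norm_exp_Qm del: norm_exp_eq_Re)
  then have "((\<lambda>k. ?u * ?z * ?z ^ k) has_sum (?u * ?z * (?z / (1 - ?z)))) {1..}"
    by (intro has_sum_cmult_right has_sum_geometric_from_1)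
  moreover have "?u * ?z * (?z / (1 - ?z)) = mode_term d \<xi> \<eta> \<beta> t s m"
  proof -
    have "exp (- 2 * Qm d \<xi> \<eta> \<beta> m) = ?z * ?z" by (simp add: exp_add[symmetric])
    then show ?thesis by (simp add: mode_term_def)
  qed
  ultimately have sum: "((\<lambda>k. ?u * ?z * ?z ^ k) has_sum mode_term d \<xi> \<eta> \<beta> t s m) {1..}" by simp
  let ?a = "\<lambda>n::int. of_real (exp (- (snd t - snd s - of_int n * \<eta>) * chi d \<beta> m) / (2 * d * chi d \<beta> m)) *
      cis (alpha d m * (fst t - fst s - of_int n * \<xi>))"
  have summand: "?a (- int k - 1) = ?u * ?z * ?z ^ k" for k
  proof -
    have "?u * ?z * ?z ^ k = exp (- of_real (chi d \<beta> m * snd t) + \<i> * of_real (alpha d m * fst t)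
        + (of_real (chi d \<beta> m * snd s) - \<i> * of_real (alpha d m * fst s)) - Qm d \<xi> \<eta> \<beta> m - of_nat k * Qm d \<xi> \<eta> \<beta> m)
        / of_real (2 * d * chi d \<beta> m)"
      by (simp add: exp_add exp_diff exp_minus exp_of_real[symmetric] exp_of_nat_mult field_simps)
    also have "- of_real (chi d \<beta> m * snd t) + \<i> * of_real (alpha d m * fst t)
        + (of_real (chi d \<beta> m * snd s) - \<i> * of_real (alpha d m * fst s)) - Qm d \<xi> \<eta> \<beta> m - of_nat k * Qm d \<xi> \<eta> \<beta> m
      = of_real (- (snd t - snd s - of_int (- int k - 1) * \<eta>) * chi d \<beta> m)
        + \<i> * of_real (alpha d m * (fst t - fst s - of_int (- int k - 1) * \<xi>))"
      by (simp add: Qm_def complex_eq_iff algebra_simps)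
    finally show ?thesis by (simp only: exp_add exp_of_real cis_conv_exp of_real_divide times_divide_eq_left)
  qed
  have "((\<lambda>k. ?u * ?z * ?z ^ k) has_sum mode_term d \<xi> \<eta> \<beta> t s m) {1..} =
      (?a has_sum mode_term d \<xi> \<eta> \<beta> t s m) {..-2}"
  proof (rule has_sum_reindex_bij_witness[where i = "\<lambda>n. nat (- n - 1)" and j = "\<lambda>k. - int k - 1"])
    show "?a (- int k - 1) = ?u * ?z * ?z ^ k" for k by (rule summand)
  qed auto
  with sum show ?thesis by (simp only:)
qed

text \<open>Justifies exchanging rows and modes. The vertical distance is at least
  \<open>(\<bar>n\<bar> - 1) * \<eta>\<close> and \<open>chi\<close> dominates the average of
  \<beta> and \<open>\<bar>alpha d m\<bar>\<close>, so the product of the two gives exponential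
  decay in n and in m separately.\<close>

lemma summable_on_mode_rows:
  assumes d: "d > 0" and \<eta>: "\<eta> > 0" and \<beta>: "\<beta> > 0" and le: "- \<eta> \<le> snd t - snd s"
  shows "(\<lambda>(n, m). of_real (exp (- (snd t - snd s - of_int n * \<eta>) * chi d \<beta> m) / (2 * d * chi d \<beta> m)) *
      cis (alpha d m * (fst t - fst s - of_int n * \<xi>)) :: complex) summable_on {..-2::int} \<times> UNIV"
    (is "(\<lambda>(n, m). ?A n m) summable_on _")
proof (rule Infinite_Sum.abs_summable_summable, rule Infinite_Sum.abs_summable_on_comparison_test')
  \<comment> \<open>The halves in \<open>a\<close> and \<open>b\<close> come from averaging the two
    lower bounds for \<open>chi\<close>; the factor \<open>exp a\<close> in \<open>C\<close>
    compensates for \<open>\<bar>n\<bar> - 1\<close> in place of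
    \<open>\<bar>n\<bar>\<close>.\<close>
  define a where "a = \<eta> * \<beta> / 2"
  define b where "b = \<eta> * pi / d"
  define C where "C = exp a / (2 * d * \<beta>)"
  define B where "B n m = C * exp (- a * \<bar>of_int n\<bar>) * exp (- b * \<bar>of_int m\<bar>)" for n m :: int
  have ab: "a > 0" "b > 0" using \<eta> \<beta> d by (auto simp: a_def b_def)
  have C: "C > 0" using d \<beta> by (simp add: C_def)
  obtain S where S: "((\<lambda>m::int. exp (- b * \<bar>of_int m\<bar>) :: real) has_sum S) UNIV"
    using summable_on_exp_minus_abs_int[OF ab(2)] unfolding summable_on_def by blast
  have "(\<lambda>n::int. exp (- a * \<bar>of_int n\<bar>) :: real) summable_on {..-2}"
    using summable_on_exp_minus_abs_int[OF ab(1)] by (rule summable_on_subset) auto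
  then have "(\<lambda>n::int. C * exp (- a * \<bar>of_int n\<bar>) * S) summable_on {..-2}"
    by (intro summable_on_cmult_left summable_on_cmult_right)
  then show "(\<lambda>(n, m). B n m) summable_on {..-2::int} \<times> UNIV"
  proof (rule summable_on_SigmaI[rotated])
    fix n :: int
    show "((\<lambda>m. case (n, m) of (n, m) \<Rightarrow> B n m) has_sum C * exp (- a * \<bar>of_int n\<bar>) * S) UNIV"
      unfolding B_def prod.case by (intro has_sum_cmult_right S)
  qed (use C in \<open>auto simp: B_def\<close>)
  fix x :: "int \<times> int" assume "x \<in> {..-2} \<times> UNIV"
  then obtain n m where x: "x = (n, m)" and n: "n \<le> -2" by auto
  let ?Y = "snd t - snd s - of_int n * \<eta>" and ?\<chi> = "chi d \<beta> m"
  have n': "real_of_int n \<le> -2" using n by linarith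
  have \<chi>: "?\<chi> \<ge> \<beta>" using \<beta> by (intro chi_ge) simp
  have "(\<bar>of_int n\<bar> - 1) * \<eta> = - of_int n * \<eta> - \<eta>" using n' by (simp add: algebra_simps)
  also have "\<dots> \<le> ?Y" using le by simp
  finally have Y: "(\<bar>of_int n\<bar> - 1) * \<eta> \<le> ?Y" .
  have "0 \<le> (\<bar>of_int n\<bar> - 1) * \<eta>" using n' \<eta> by simp
  with Y have Y0: "0 \<le> ?Y" by (rule order_trans[rotated])
  \<comment> \<open>Since \<open>\<bar>n\<bar> - 1\<close> is at least 1, it can be inserted into
    the part that supplies decay in m.\<close>
  have "(\<bar>of_int n\<bar> - 1) * \<eta> * (\<beta> / 2) + \<eta> * (\<bar>alpha d m\<bar> / 2) \<le> (\<bar>of_int n\<bar> - 1) * \<eta> * (\<beta> / 2) + (\<bar>of_int n\<bar> - 1) * \<eta> * (\<bar>alpha d m\<bar> / 2)"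
    using n' \<eta> by (intro add_left_mono mult_right_mono) auto
  also have "\<dots> = (\<bar>of_int n\<bar> - 1) * \<eta> * ((\<beta> + \<bar>alpha d m\<bar>) / 2)" by (simp add: field_simps)
  also have "\<dots> \<le> ?Y * ?\<chi>"
    using Y0 \<beta> \<chi> chi_ge_abs_alpha[of d m \<beta>] by (intro mult_mono Y) auto
  finally have "(\<bar>of_int n\<bar> - 1) * \<eta> * (\<beta> / 2) + \<eta> * (\<bar>alpha d m\<bar> / 2) \<le> ?Y * ?\<chi>" .
  moreover have "(\<bar>of_int n\<bar> - 1) * \<eta> * (\<beta> / 2) + \<eta> * (\<bar>alpha d m\<bar> / 2) = - a + a * \<bar>of_int n\<bar> + b * \<bar>of_int m\<bar>"
    using d by (simp add: a_def b_def abs_alpha field_simps)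
  ultimately have "- (?Y * ?\<chi>) \<le> a + - a * \<bar>of_int n\<bar> + - b * \<bar>of_int m\<bar>"
    by linarith
  then have "- ?Y * ?\<chi> \<le> a + - a * \<bar>of_int n\<bar> + - b * \<bar>of_int m\<bar>"
    by (simp only: minus_mult_left)
  then have "exp (- ?Y * ?\<chi>) \<le> exp (a + - a * \<bar>of_int n\<bar> + - b * \<bar>of_int m\<bar>)" by (simp only: exp_le_cancel_iff)
  then have "exp (- ?Y * ?\<chi>) / (2 * d * ?\<chi>) \<le> exp (a + - a * \<bar>of_int n\<bar> + - b * \<bar>of_int m\<bar>) / (2 * d * \<beta>)"
    using d \<beta> \<chi> by (intro frac_le mult_left_mono) auto
  also have "\<dots> = B n m" unfolding B_def C_def exp_add by simp
  finally show "norm (case x of (n, m) \<Rightarrow> ?A n m) \<le> (case x of (n, m) \<Rightarrow> B n m)"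
    using d \<beta> \<chi> by (simp add: x norm_mult norm_divide)
qed

text \<open>Each row is expanded into modes by Poisson summation; absolute summability then permits
  summing over n first, where the geometric series applies.\<close>

lemma K2_south_eq_mode_sum:
  assumes d: "d > 0" and \<eta>: "\<eta> > 0" and \<beta>: "\<beta> > 0" and le: "- \<eta> \<le> snd t - snd s"
  shows "complex_of_real (K2_south d \<xi> \<eta> \<beta> t s) = (\<Sum>\<^sub>\<infinity>m. mode_term d \<xi> \<eta> \<beta> t s m)"
proof -
  let ?a = "\<lambda>n m. of_real (exp (- (snd t - snd s - of_int n * \<eta>) * chi d \<beta> m) / (2 * d * chi d \<beta> m)) *
      cis (alpha d m * (fst t - fst s - of_int n * \<xi>)) :: complex"
  note summable = summable_on_mode_rows[OF assms, of \<xi>]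
  have row: "complex_of_real (\<Sum>\<^sub>\<infinity>m. green \<beta> t (s + lattice_pt d \<xi> \<eta> m n)) = (\<Sum>\<^sub>\<infinity>m. ?a n m)"
    if "n \<in> {..-2}" for n :: int
  proof (rule green_row_sum[OF \<beta> d])
    \<comment> \<open>Rows from -2 downwards add at least \<open>2 * \<eta>\<close>, so a vertical
      offset of at least \<eta> remains.\<close>
    have "2 * \<eta> \<le> - of_int n * \<eta>" using that \<eta> by (intro mult_right_mono) auto
    then show "snd t - snd s - of_int n * \<eta> > 0" using le \<eta> by simp
  qed
  \<comment> \<open>Summability of the row sums is carried over to the real family, so that the
    outer sum in \<open>K2_south\<close> is a genuine limit and not a default value.\<close>
  have "(\<lambda>n. \<Sum>\<^sub>\<infinity>m. ?a n m) summable_on {..-2}"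
    using summable_on_Sigma_banach[OF summable] by simp
  then have "(\<lambda>n. complex_of_real (\<Sum>\<^sub>\<infinity>m. green \<beta> t (s + lattice_pt d \<xi> \<eta> m n))) summable_on {..-2}"
    by (subst summable_on_cong[OF row])
  then have "(\<lambda>n. \<Sum>\<^sub>\<infinity>m. green \<beta> t (s + lattice_pt d \<xi> \<eta> m n)) summable_on {..-2}"
    using summable_on_Re by fastforce
  then have "((\<lambda>n. complex_of_real (\<Sum>\<^sub>\<infinity>m. green \<beta> t (s + lattice_pt d \<xi> \<eta> m n))) has_sum complex_of_real (K2_south d \<xi> \<eta> \<beta> t s)) {..-2}"
    unfolding K2_south_def by (intro has_sum_of_real has_sum_infsum)
  then have "complex_of_real (K2_south d \<xi> \<eta> \<beta> t s) = (\<Sum>\<^sub>\<infinity>n\<in>{..-2}. complex_of_real (\<Sum>\<^sub>\<infinity>m. green \<beta> t (s + lattice_pt d \<xi> \<eta> m n)))"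
    by (simp add: infsumI)
  also have "\<dots> = (\<Sum>\<^sub>\<infinity>n\<in>{..-2}. \<Sum>\<^sub>\<infinity>m. ?a n m)"
    by (intro infsum_cong row)
  also have "\<dots> = (\<Sum>\<^sub>\<infinity>m. \<Sum>\<^sub>\<infinity>n\<in>{..-2}. ?a n m)"
    by (rule infsum_swap_banach[OF summable])
  also have "\<dots> = (\<Sum>\<^sub>\<infinity>m. mode_term d \<xi> \<eta> \<beta> t s m)"
    by (intro infsum_cong infsumI has_sum_mode_rows \<eta> \<beta>)
  finally show ?thesis .
qed

text \<open>The positions of target and source cost at most a factor
  \<open>exp (chi d \<beta> m * \<eta>)\<close>, which uses up one of the two factors in
  \<open>exp (- 2 * Qm d \<xi> \<eta> \<beta> m)\<close>; the other gives the geometric decay. The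
  denominator is bounded below uniformly in m by the reverse triangle inequality.\<close>

lemma norm_mode_term_le:
  assumes d: "d > 0" and \<eta>: "\<eta> > 0" and \<beta>: "\<beta> > 0" and le: "- \<eta> \<le> snd t - snd s"
  shows "norm (mode_term d \<xi> \<eta> \<beta> t s m) \<le>
    1 / (2 * d * \<beta> * (1 - exp (- (\<beta> * \<eta>)))) * exp (- 2 * pi * \<eta> / d) ^ nat \<bar>m\<bar>"
proof -
  let ?\<chi> = "chi d \<beta> m" and ?z = "exp (- Qm d \<xi> \<eta> \<beta> m)"
  have \<chi>: "?\<chi> \<ge> \<beta>" using \<beta> by (intro chi_ge) simp
  have "exp (- (?\<chi> * \<eta>)) \<le> exp (- (\<beta> * \<eta>))" using \<chi> \<eta> by simp
  then have "1 - exp (- (\<beta> * \<eta>)) \<le> 1 - norm ?z" by (simp add: norm_exp_Qm del: norm_exp_eq_Re)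
  also have "\<dots> \<le> norm (1 - ?z)" using norm_triangle_ineq2[of 1 ?z] by simp
  finally have den: "1 - exp (- (\<beta> * \<eta>)) \<le> norm (1 - ?z)" .
  have pos: "1 - exp (- (\<beta> * \<eta>)) > 0" using \<beta> \<eta> by simp
  have "exp (- 2 * Qm d \<xi> \<eta> \<beta> m) = ?z * ?z" by (simp add: exp_add[symmetric])
  then have "norm (exp (- 2 * Qm d \<xi> \<eta> \<beta> m)) = exp (- (?\<chi> * \<eta>)) * exp (- (?\<chi> * \<eta>))"
    by (simp only: norm_mult norm_exp_Qm)
  then have "norm (mode_term d \<xi> \<eta> \<beta> t s m) =
      exp (- ?\<chi> * snd t) * (1 / (2 * d * ?\<chi>) * (exp (- (?\<chi> * \<eta>)) * exp (- (?\<chi> * \<eta>)) / norm (1 - ?z))) * exp (?\<chi> * snd s)"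
    using d \<beta> \<chi> by (simp add: mode_term_def norm_mult norm_divide)
  also have "\<dots> = exp (- ?\<chi> * snd t + ?\<chi> * snd s + - (?\<chi> * \<eta>) + - (?\<chi> * \<eta>)) / (2 * d * ?\<chi> * norm (1 - ?z))"
    unfolding exp_add by simp
  also have "\<dots> \<le> exp (- 2 * pi * \<eta> / d) ^ nat \<bar>m\<bar> / (2 * d * \<beta> * (1 - exp (- (\<beta> * \<eta>))))"
  proof (intro frac_le mult_mono)
    have "?\<chi> * - \<eta> \<le> ?\<chi> * (snd t - snd s)" using \<chi> \<beta> le by (intro mult_left_mono) auto
    then have "- ?\<chi> * snd t + ?\<chi> * snd s + - (?\<chi> * \<eta>) + - (?\<chi> * \<eta>) \<le> - (?\<chi> * \<eta>)" by (simp add: algebra_simps)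
    also have "\<dots> \<le> - (\<bar>alpha d m\<bar> * \<eta>)"
      using chi_ge_abs_alpha[of d m \<beta>] \<eta> by simp
    also have "\<dots> = of_nat (nat \<bar>m\<bar>) * (- 2 * pi * \<eta> / d)"
      using d by (simp add: abs_alpha)
    finally show "exp (- ?\<chi> * snd t + ?\<chi> * snd s + - (?\<chi> * \<eta>) + - (?\<chi> * \<eta>)) \<le> exp (- 2 * pi * \<eta> / d) ^ nat \<bar>m\<bar>"
      unfolding exp_of_nat_mult[symmetric] by (simp only: exp_le_cancel_iff)
  qed (use d \<beta> \<chi> den pos in auto)
  finally show ?thesis by simp
qed

text \<open>\<open>trunc_M\<close> solves the corresponding equality for the exponent and rounds up,
  which can only decrease the power. The factor \<open>1 - q\<close>, with q the base of the power,
  cancels the denominator of the geometric tail.\<close>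

lemma exp_trunc_M_le:
  assumes d: "d > 0" and \<eta>: "\<eta> > 0" and \<epsilon>: "0 < \<epsilon>"
  shows "exp (- 2 * pi * \<eta> / d) ^ trunc_M d \<eta> \<epsilon> \<le> (1 - exp (- 2 * pi * \<eta> / d)) * \<epsilon>"
proof -
  let ?q = "exp (- 2 * pi * \<eta> / d)" and ?M = "trunc_M d \<eta> \<epsilon>"
  have q: "?q < 1" using d \<eta> by simp
  have "d / (2 * pi * \<eta>) * ln (1 / (1 - ?q) * (1 / \<epsilon>)) \<le> real ?M"
    unfolding trunc_M_def by linarith
  then have "(2 * pi * \<eta> / d) * (d / (2 * pi * \<eta>) * ln (1 / (1 - ?q) * (1 / \<epsilon>))) \<le> (2 * pi * \<eta> / d) * real ?M"
    using d \<eta> by (intro mult_left_mono) auto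
  then have "ln (1 / (1 - ?q) * (1 / \<epsilon>)) \<le> (2 * pi * \<eta> / d) * real ?M" using d \<eta> by simp
  moreover have "ln ((1 - ?q) * \<epsilon>) = - ln (1 / (1 - ?q) * (1 / \<epsilon>))"
    using q \<epsilon> by (simp add: ln_div ln_mult)
  ultimately have "of_nat ?M * (- 2 * pi * \<eta> / d) \<le> ln ((1 - ?q) * \<epsilon>)"
    by (simp add: mult.commute)
  then have "exp (of_nat ?M * (- 2 * pi * \<eta> / d)) \<le> exp (ln ((1 - ?q) * \<epsilon>))"
    by (simp only: exp_le_cancel_iff)
  also have "exp (ln ((1 - ?q) * \<epsilon>)) = (1 - ?q) * \<epsilon>" using q \<epsilon> by (intro exp_ln) simp
  finally show ?thesis by (simp only: exp_of_nat_mult)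
qed

section \<open>Truncation of the mode series\<close>

lemma mode_sum_truncation_error:
  assumes d: "d > 0" and \<eta>: "\<eta> > 0" and \<beta>: "\<beta> > 0" and \<epsilon>: "0 < \<epsilon>" and le: "- \<eta> \<le> snd t - snd s"
  defines "M \<equiv> trunc_M d \<eta> \<epsilon>"
  shows "norm (of_real (K2_south d \<xi> \<eta> \<beta> t s) - (\<Sum>m\<in>{- int M..int M}. mode_term d \<xi> \<eta> \<beta> t s m)) \<le>
    1 / (d * \<beta> * (1 - exp (- (\<beta> * \<eta>)))) * \<epsilon>"
proof -
  define q where "q = exp (- 2 * pi * \<eta> / d)"
  \<comment> \<open>The constant of the mode bound; the two tails together double it, which removes
    the 2 from its denominator in the final estimate.\<close>
  define K where "K = 1 / (2 * d * \<beta> * (1 - exp (- (\<beta> * \<eta>))))"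
  let ?b = "mode_term d \<xi> \<eta> \<beta> t s"
  let ?T = "{m. int M < \<bar>m\<bar>}"
  have q: "0 \<le> q" "q < 1" using d \<eta> by (auto simp: q_def)
  have K: "K \<ge> 0" using d \<beta> \<eta> by (simp add: K_def)
  have b_le: "norm (?b m) \<le> K * q ^ nat \<bar>m\<bar>" for m
    unfolding K_def q_def by (rule norm_mode_term_le[OF d \<eta> \<beta> le])
  have tail: "((\<lambda>m. K * q ^ nat \<bar>m\<bar>) has_sum K * (2 * q ^ Suc M / (1 - q))) ?T"
    by (intro has_sum_cmult_right has_sum_power_int_tail q)
  have "(\<lambda>m. norm (?b m)) summable_on ?T"
    by (rule Infinite_Sum.abs_summable_on_comparison_test'[OF has_sum_imp_summable[OF tail] b_le])
  then have bT: "?b summable_on ?T" by (rule abs_summable_summable)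
  have "(?b has_sum (sum ?b {- int M..int M} + infsum ?b ?T)) ({- int M..int M} \<union> ?T)"
    using bT by (intro has_sum_Un_disjoint has_sum_infsum) auto
  moreover have "{- int M..int M} \<union> ?T = UNIV" by auto
  ultimately have "of_real (K2_south d \<xi> \<eta> \<beta> t s) = sum ?b {- int M..int M} + infsum ?b ?T"
    by (simp add: K2_south_eq_mode_sum[OF d \<eta> \<beta> le] infsumI)
  then have "norm (of_real (K2_south d \<xi> \<eta> \<beta> t s) - sum ?b {- int M..int M}) = norm (infsum ?b ?T)" by simp
  also have "\<dots> \<le> K * (2 * q ^ Suc M / (1 - q))"
    by (rule norm_infsum_le[OF has_sum_infsum[OF bT] tail b_le])
  also have "\<dots> \<le> K * (2 * \<epsilon>)"
  proof (intro mult_left_mono K)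
    \<comment> \<open>The tail starts at \<open>Suc M\<close>; its extra factor \<open>q\<close> is
      simply bounded by 1.\<close>
    have "q ^ Suc M \<le> q ^ M" using q by (intro power_decreasing) auto
    also have "\<dots> \<le> (1 - q) * \<epsilon>" unfolding q_def M_def by (rule exp_trunc_M_le[OF d \<eta> \<epsilon>])
    finally show "2 * q ^ Suc M / (1 - q) \<le> 2 * \<epsilon>" using q by (simp add: divide_le_eq mult.commute)
  qed
  also have "\<dots> = 1 / (d * \<beta> * (1 - exp (- (\<beta> * \<eta>)))) * \<epsilon>" by (simp add: K_def)
  finally show ?thesis .
qed

section \<open>From mode sums to matrix entries\<close>

text \<open>Two points of the cell therefore differ vertically by at most \<eta>, which is the
  offset condition required of target and source.\<close>

lemma snd_unit_cell:
  assumes "t \<in> unit_cell d \<xi> \<eta>" "\<eta> > 0"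
  shows "\<bar>snd t\<bar> \<le> \<eta> / 2"
proof -
  obtain x1 x2 where "t = x1 *\<^sub>R e1 d + x2 *\<^sub>R e2 \<xi> \<eta>" and x2: "x2 \<in> {-1/2..1/2}"
    using assms unfolding unit_cell_def by auto
  then have "snd t = x2 * \<eta>" by (simp add: e1_def e2_def)
  moreover have "\<bar>x2\<bar> * \<eta> \<le> 1 / 2 * \<eta>" using x2 assms by (intro mult_right_mono) auto
  ultimately show ?thesis using assms by (simp add: abs_mult)
qed

lemma index_mult_LDR_south:
  assumes "l < NT" "j < NS"
  shows "(L_south d \<beta> M NT t * D_south d \<xi> \<eta> \<beta> M * R_south d \<beta> M NS s) $$ (l, j) =
    (\<Sum>m\<in>{- int M..int M}. mode_term d \<xi> \<eta> \<beta> (t l) (s j) m)"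
proof -
  have dims: "L_south d \<beta> M NT t \<in> carrier_mat NT (2 * M + 1)" by (simp add: L_south_def)
  have "(L_south d \<beta> M NT t * D_south d \<xi> \<eta> \<beta> M * R_south d \<beta> M NS s) $$ (l, j) =
    (\<Sum>i = 0..<2 * M + 1. mode_term d \<xi> \<eta> \<beta> (t l) (s j) (mode M i))"
    unfolding D_south_def mat_diag_mult_right[OF dims] using assms
    by (simp add: L_south_def R_south_def scalar_prod_def mode_term_def Let_def del: of_real_mult)
  also have "\<dots> = (\<Sum>m\<in>{- int M..int M}. mode_term d \<xi> \<eta> \<beta> (t l) (s j) m)"
    \<comment> \<open>Shifts the zero-based matrix index by \<open>M\<close> to recover the mode
      number.\<close>
    by (rule sum.reindex_bij_witness[where i = "\<lambda>m. nat (m + int M)" and j = "mode M"]) (auto simp: mode_def)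
  finally show ?thesis .
qed

theorem theorem1:
  fixes d \<xi> \<eta> \<beta> :: real
  assumes "d > 0" and "\<eta> > 0" and "d \<ge> sqrt (\<xi>\<^sup>2 + \<eta>\<^sup>2)" and "\<beta> > 0"
  shows "\<exists>C>0. \<forall>\<epsilon>. 0 < \<epsilon> \<and> \<epsilon> < 1 \<longrightarrow>
    (\<forall>(NT::nat) (NS::nat) (t :: nat \<Rightarrow> real \<times> real) (s :: nat \<Rightarrow> real \<times> real).
       (\<forall>l<NT. t l \<in> unit_cell d \<xi> \<eta>) \<longrightarrow> (\<forall>j<NS. s j \<in> unit_cell d \<xi> \<eta>) \<longrightarrow>
       (let M = trunc_M d \<eta> \<epsilon> in
        \<exists>E \<in> carrier_mat NT NS.
          P2_south d \<xi> \<eta> \<beta> NT NS t s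
            = L_south d \<beta> M NT t * D_south d \<xi> \<eta> \<beta> M * R_south d \<beta> M NS s + E \<and>
          (\<forall>l<NT. \<forall>j<NS. cmod (E $$ (l, j)) \<le> C * \<epsilon>)))"
proof (intro exI[of _ "1 / (d * \<beta> * (1 - exp (- (\<beta> * \<eta>))))"] conjI allI impI)
  show "1 / (d * \<beta> * (1 - exp (- (\<beta> * \<eta>)))) > 0" using assms by simp
  fix \<epsilon> :: real and NT NS :: nat and t s :: "nat \<Rightarrow> real \<times> real"
  assume \<epsilon>: "0 < \<epsilon> \<and> \<epsilon> < 1" and t: "\<forall>l<NT. t l \<in> unit_cell d \<xi> \<eta>" and s: "\<forall>j<NS. s j \<in> unit_cell d \<xi> \<eta>"
  define M where "M = trunc_M d \<eta> \<epsilon>"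
  let ?LDR = "L_south d \<beta> M NT t * D_south d \<xi> \<eta> \<beta> M * R_south d \<beta> M NS s"
  \<comment> \<open>The error matrix is the difference itself. Its entrywise bound depends only on
    \<open>d\<close>, \<eta>, \<beta> and \<epsilon>, hence is uniform in all sources and
    targets.\<close>
  let ?E = "P2_south d \<xi> \<eta> \<beta> NT NS t s - ?LDR"
  have LDR: "?LDR \<in> carrier_mat NT NS"
    by (auto simp: L_south_def R_south_def)
  have P: "P2_south d \<xi> \<eta> \<beta> NT NS t s \<in> carrier_mat NT NS"
    by (simp add: P2_south_def)
  have E: "?E \<in> carrier_mat NT NS" by (rule minus_carrier_mat[OF LDR])
  have "cmod (?E $$ (l, j)) \<le> 1 / (d * \<beta> * (1 - exp (- (\<beta> * \<eta>)))) * \<epsilon>" if lj: "l < NT" "j < NS" for l j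
  proof -
    have "- \<eta> \<le> snd (t l) - snd (s j)"
      using snd_unit_cell[of "t l" d \<xi> \<eta>] snd_unit_cell[of "s j" d \<xi> \<eta>] t s lj assms by auto
    note mode_sum_truncation_error[OF \<open>d > 0\<close> \<open>\<eta> > 0\<close> \<open>\<beta> > 0\<close> conjunct1[OF \<epsilon>] this, of \<xi>]
    moreover have "?E $$ (l, j) = of_real (K2_south d \<xi> \<eta> \<beta> (t l) (s j)) -
        (\<Sum>m\<in>{- int M..int M}. mode_term d \<xi> \<eta> \<beta> (t l) (s j) m)"
    proof -
      have "?E $$ (l, j) = P2_south d \<xi> \<eta> \<beta> NT NS t s $$ (l, j) - ?LDR $$ (l, j)"
        using carrier_matD[OF LDR] lj by (intro index_minus_mat) auto
      then show ?thesis using lj by (simp only: index_mult_LDR_south) (simp add: P2_south_def)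
    qed
    ultimately show ?thesis by (simp add: M_def)
  qed
  moreover have "P2_south d \<xi> \<eta> \<beta> NT NS t s = ?LDR + ?E"
    using LDR P by (intro eq_matI) auto
  ultimately show "let M = trunc_M d \<eta> \<epsilon> in
        \<exists>E \<in> carrier_mat NT NS.
          P2_south d \<xi> \<eta> \<beta> NT NS t s
            = L_south d \<beta> M NT t * D_south d \<xi> \<eta> \<beta> M * R_south d \<beta> M NS s + E \<and>
          (\<forall>l<NT. \<forall>j<NS. cmod (E $$ (l, j)) \<le> 1 / (d * \<beta> * (1 - exp (- (\<beta> * \<eta>)))) * \<epsilon>)"
    unfolding Let_def M_def[symmetric] using E by (intro bexI[of _ ?E]) blast+
qed

end
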